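(* Let $\mathcal T$ be a kite and dart tiling whose kites have longest edges of length $1$, with coordinates normalized as described in the context. Then the compact connected symplectic quasifold $M_\Delta$ corresponding to each kite $\Delta$ of $\mathcal T$ is $M_0^+$.
   Context: **Kites, darts and tilings.** Let $\phi=\frac{1+\sqrt5}{2}$. A kite (with longest edges of length $1$) is a quadrilateral with consecutive vertices $E,B,A,G$, interior angles $2\pi/5$ at $E,B,G$ and $4\pi/5$ at $A$, with $|EB|=|EG|=|EA|=1$ and $|AB|=|AG|=1/\phi$. A dart is a nonconvex quadrilateral with consecutive vertices $F,B,A,G$, interior angles $2\pi/5$ at $F$, $\pi/5$ at $B$ and $G$, $6\pi/5$ at $A$, with $|FB|=|FG|=1$ and $|AB|=|AG|=1/\phi$. A kite and dart tiling is an edge-to-edge tiling of the plane by such kites and darts obeying the Penrose matching rules: colour black the vertices $E,A$ of each kite and $B,G$ of each dart, and colour white the vertices $B,G$ of each kite and $A,F$ of each dart; tiles may only be joined so that the vertex colours agree. **Vectors and quasilattice.** For $k\in\{0,\dots,4\}$ (indices modulo $5$) let $Y_k=(\cos\frac{2\pi k}{5},\sin\frac{2\pi k}{5})$ and $Y_k^*=(-\sin\frac{2\pi k}{5},\cos\frac{2\pi k}{5})$. Let $Q=\mathrm{Span}_{\mathbb Z}\{Y_0,\dots,Y_4\}\subset\mathbb R^2$. Let $\Delta_k^+$ (resp. $\Delta_k^-$) be the kite with $E$ at the origin and $A-E=Y_k^*$ (resp. $A-E=-Y_k^*$). Kites are regarded as polytopes in $(\mathbb R^2)^*\cong\mathbb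 R^2$ (identified by the standard inner product). **Coordinates.** Coordinates on the plane of the tiling are chosen so that some edge of the tiling has one endpoint at the origin $O$ and the other endpoint is a positive multiple of $Y_0^*$. With this choice each kite of the tiling is a translate of one of the ten kites $\Delta_k^\pm$. **Choice of normals.** If $\Delta$ is a translate of $\Delta_k^+$, put $(X_1,X_2,X_3,X_4)=(-Y_{k+1},Y_{k+2},-Y_{k+3},Y_{k+4})$; if $\Delta$ is a translate of $\Delta_k^-$, put $(X_1,X_2,X_3,X_4)=(Y_{k+1},-Y_{k+2},Y_{k+3},-Y_{k+4})$. These are inward-pointing and orthogonal to the four edges of $\Delta$, so there are unique $\lambda_1,\dots,\lambda_4\in\mathbb R$ with $\Delta=\bigcap_{j=1}^4\{\mu\mid\langle\mu,X_j\rangle\ge\lambda_j\}$ and each of the four inequalities defining an edge. **Generalized Delzant procedure (with respect to $Q$ and the $X_j$).** Let $\pi:\mathbb R^4\to\mathbb R^2$ be the linear map $e_j\mapsto X_j$, let $T^4=\mathbb R^4/\mathbb Z^4$ act on $\mathbb C^4$ in the standard way by $\exp(\theta)\cdot z=(e^{2\pi i\theta_1}z_1,\dots,e^{2\pi i\theta_4}z_4)$, and let $N=\{\exp(X)\in T^4\mid X\in\mathbb R^4,\ \pi(X)\in Q\}$ with Lie algebra $\mathfrak n=\ker\pi$ and inclusion $i:\mathfrak n\to\mathbb R^4$. Equip $\mathbb C^4$ with $\omega_0=\frac{1}{2\pi i}\sum_j dz_j\wedge d\bar z_j$ and put $J(z)=\sum_j(|z_j|^2+\lambda_j)e_j^*$,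 $\Psi=i^*\circ J:\mathbb C^4\to\mathfrak n^*$. Then $M_\Delta=\Psi^{-1}(0)/N$ (quotient topology). A quasifold is a space locally modelled on quotients of manifolds by smooth actions of discrete groups. The quasifold structure of $M_\Delta$ is given by four charts, one for each vertex of $\Delta$. If the vertex is the intersection of the edges with normals $X_i$ and $X_j$, and $\{k,l\}=\{1,2,3,4\}\setminus\{i,j\}$, let $\tilde U_{ij}\subset\mathbb C^2$ be the open set of those $(z_i,z_j)$ for which there are (necessarily unique) real numbers $z_k>0$, $z_l>0$ with $(z_1,z_2,z_3,z_4)\in\Psi^{-1}(0)$; let $\Gamma_{ij}$ be the discrete group of elements of $N$ whose $k$-th and $l$-th components are $1$, acting on $\tilde U_{ij}$ through its $i$-th and $j$-th components; let $U_{ij}=\{z\in\Psi^{-1}(0)\mid z_k\ne0,z_l\neq0\}/N$. The chart is the homeomorphism $\tilde U_{ij}/\Gamma_{ij}\to U_{ij}$ sending $[(z_i,z_j)]$ to the class of $(z_1,z_2,z_3,z_4)$. The symplectic form of $M_\Delta$ is given on each chart by the restriction to $\tilde U_{ij}$ of the standard form $\frac1{2\pi i}(dz_i\wedge d\bar z_i+dz_j\wedge d\bar z_j)$. $M_0^+$ denotes the symplectic quasifold $M_{\Delta_0^+}$, obtained from $\Delta_0^+$ with normals $-Y_1,Y_2,-Y_3,Y_4$. *)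

theory Defs
  imports "HOL-Analysis.Analysis"
begin

text \<open>The plane, together with its dual, is \<^typ>\<open>complex\<close>, regarded as the Euclidean plane with
  its inner product \<^const>\<open>inner\<close>.\<close>

section \<open>Kites, darts and tilings\<close>

definition golden :: real where
  "golden = (1 + sqrt 5) / 2"

text \<open>The interior angle at the vertex \<open>V\<close> of a polygon, where \<open>P\<close> and \<open>S\<close> are the vertices
  preceding and following \<open>V\<close> in the counterclockwise order of the boundary. It takes values in
  \<open>[0, 2 pi)\<close>, so reflex angles are covered.\<close>

definition interior_angle :: "complex \<Rightarrow> complex \<Rightarrow> complex \<Rightarrow> real" where
  "interior_angle P V S = Arg2pi ((P - V) / (S - V))"

text \<open>Vertices are listed counterclockwise. This loses no kite and no dart: both are symmetric
  under the reflection that exchanges \<open>B\<close> and \<open>G\<close>. It makes the labelling of a tile unique.\<close>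

definition is_kite :: "complex \<Rightarrow> complex \<Rightarrow> complex \<Rightarrow> complex \<Rightarrow> bool" where
  "is_kite E B A G \<longleftrightarrow>
     dist E B = 1 \<and> dist E G = 1 \<and> dist E A = 1 \<and>
     dist A B = 1 / golden \<and> dist A G = 1 / golden \<and>
     interior_angle G E B = 2 * pi / 5 \<and> interior_angle E B A = 2 * pi / 5 \<and>
     interior_angle B A G = 4 * pi / 5 \<and> interior_angle A G E = 2 * pi / 5"

definition is_dart :: "complex \<Rightarrow> complex \<Rightarrow> complex \<Rightarrow> complex \<Rightarrow> bool" where
  "is_dart F B A G \<longleftrightarrow>
     dist F B = 1 \<and> dist F G = 1 \<and>
     dist A B = 1 / golden \<and> dist A G = 1 / golden \<and>
     interior_angle G F B = 2 * pi / 5 \<and> interior_angle F B A = pi / 5 \<and>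
     interior_angle B A G = 6 * pi / 5 \<and> interior_angle A G F = pi / 5"

datatype tile =
    Kite complex complex complex complex
  | Dart complex complex complex complex

primrec valid_tile :: "tile \<Rightarrow> bool" where
  "valid_tile (Kite E B A G) = is_kite E B A G"
| "valid_tile (Dart F B A G) = is_dart F B A G"

text \<open>A dart is cut along its axis of symmetry into two triangles.\<close>

primrec region :: "tile \<Rightarrow> complex set" where
  "region (Kite E B A G) = convex hull {E, B, A, G}"
| "region (Dart F B A G) = convex hull {F, B, A} \<union> convex hull {F, A, G}"

text \<open>An edge is represented by the set of its two endpoints.\<close>

primrec edges :: "tile \<Rightarrow> complex set set" where
  "edges (Kite E B A G) = {{E, B}, {B, A}, {A, G}, {G, E}}"
| "edges (Dart F B A G) = {{F, B}, {B, A}, {A, G}, {G, F}}"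

primrec black_vertices :: "tile \<Rightarrow> complex set" where
  "black_vertices (Kite E B A G) = {E, A}"
| "black_vertices (Dart F B A G) = {B, G}"

primrec white_vertices :: "tile \<Rightarrow> complex set" where
  "white_vertices (Kite E B A G) = {B, G}"
| "white_vertices (Dart F B A G) = {A, F}"

definition tiling :: "tile set \<Rightarrow> bool" where
  "tiling T \<longleftrightarrow>
     (\<Union>t\<in>T. region t) = UNIV \<and>
     (\<forall>t\<in>T. \<forall>t'\<in>T. t \<noteq> t' \<longrightarrow> interior (region t) \<inter> interior (region t') = {})"

text \<open>Edges of different tiles either coincide or meet at most in common endpoints.\<close>

definition edge_to_edge :: "tile set \<Rightarrow> bool" where
  "edge_to_edge T \<longleftrightarrow>
     (\<forall>t\<in>T. \<forall>t'\<in>T. t \<noteq> t' \<longrightarrow>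
       (\<forall>e\<in>edges t. \<forall>e'\<in>edges t'. e = e' \<or> convex hull e \<inter> convex hull e' \<subseteq> e \<inter> e'))"

definition matching_rules :: "tile set \<Rightarrow> bool" where
  "matching_rules T \<longleftrightarrow> (\<forall>t\<in>T. \<forall>t'\<in>T. black_vertices t \<inter> white_vertices t' = {})"

definition kite_dart_tiling :: "tile set \<Rightarrow> bool" where
  "kite_dart_tiling T \<longleftrightarrow>
     (\<forall>t\<in>T. valid_tile t) \<and> tiling T \<and> edge_to_edge T \<and> matching_rules T"

section \<open>The vectors, the quasilattice and the ten reference kites\<close>

definition Y :: "nat \<Rightarrow> complex" where
  "Y k = Complex (cos (2 * pi * real k / 5)) (sin (2 * pi * real k / 5))"

definition Ystar :: "nat \<Rightarrow> complex" where
  "Ystar k = Complex (- sin (2 * pi * real k / 5)) (cos (2 * pi * real k / 5))"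

definition Q :: "complex set" where
  "Q = {\<Sum>k<5. of_int (n k) * Y k | n :: nat \<Rightarrow> int. True}"

definition normalized_coordinates :: "tile set \<Rightarrow> bool" where
  "normalized_coordinates T \<longleftrightarrow> (\<exists>t\<in>T. \<exists>r>0. {0, r *\<^sub>R Ystar 0} \<in> edges t)"

definition Delta_plus :: "nat \<Rightarrow> complex set" where
  "Delta_plus k =
     (THE K. \<exists>E B A G. is_kite E B A G \<and> E = 0 \<and> A - E = Ystar k \<and> K = region (Kite E B A G))"

definition Delta_minus :: "nat \<Rightarrow> complex set" where
  "Delta_minus k =
     (THE K. \<exists>E B A G. is_kite E B A G \<and> E = 0 \<and> A - E = - Ystar k \<and> K = region (Kite E B A G))"

text \<open>The four coordinates are indexed by the four-element type \<^typ>\<open>4\<close>, whose elements are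
  \<open>1, 2, 3, 4\<close> (with \<open>4 = 0\<close>).\<close>

definition kite_normals :: "complex set \<Rightarrow> complex ^ 4" where
  "kite_normals D =
     (THE X. \<exists>k<5. \<exists>v.
        D = (+) v ` Delta_plus k \<and> X = vector [- Y (k+1), Y (k+2), - Y (k+3), Y (k+4)] \<or>
        D = (+) v ` Delta_minus k \<and> X = vector [Y (k+1), - Y (k+2), Y (k+3), - Y (k+4)])"

definition support_numbers :: "complex set \<Rightarrow> complex ^ 4 \<Rightarrow> real ^ 4" where
  "support_numbers D X =
     (THE l. D = (\<Inter>j. {\<mu>. \<mu> \<bullet> (X $ j) \<ge> l $ j}) \<and>
             (\<forall>j. {\<mu> \<in> D. \<mu> \<bullet> (X $ j) = l $ j} edge_of D))"

section \<open>The generalized Delzant procedure\<close>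

text \<open>The torus \<open>R^4/Z^4\<close> is identified with the group of vectors in \<open>C^4\<close> all of whose entries
  have modulus \<open>1\<close>; it acts on \<open>C^4\<close> by the componentwise product \<open>*\<close> of vectors.\<close>

definition torus_exp :: "real ^ 4 \<Rightarrow> complex ^ 4" where
  "torus_exp \<theta> = (\<chi> j. exp (2 * pi * \<i> * of_real (\<theta> $ j)))"

definition normal_map :: "complex ^ 4 \<Rightarrow> real ^ 4 \<Rightarrow> complex" where
  "normal_map X \<theta> = (\<Sum>j\<in>UNIV. (\<theta> $ j) *\<^sub>R (X $ j))"

definition group_N :: "complex set \<Rightarrow> complex ^ 4 \<Rightarrow> (complex ^ 4) set" where
  "group_N L X = {torus_exp \<theta> | \<theta>. normal_map X \<theta> \<in> L}"

definition lie_N :: "complex ^ 4 \<Rightarrow> (real ^ 4) set" where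
  "lie_N X = {\<xi>. normal_map X \<xi> = 0}"

text \<open>\<open>J\<close> takes values in the dual of \<open>R^4\<close>, whose pairing with \<open>R^4\<close> is the inner product
  of coordinate vectors; \<open>Psi\<close> is its restriction to the Lie algebra of \<open>N\<close>.\<close>

definition moment_J :: "real ^ 4 \<Rightarrow> complex ^ 4 \<Rightarrow> real ^ 4" where
  "moment_J l z = (\<chi> j. (cmod (z $ j))\<^sup>2 + l $ j)"

definition Psi :: "complex ^ 4 \<Rightarrow> real ^ 4 \<Rightarrow> complex ^ 4 \<Rightarrow> real ^ 4 \<Rightarrow> real" where
  "Psi X l z = (\<lambda>\<xi>\<in>lie_N X. moment_J l z \<bullet> \<xi>)"

definition zero_level :: "complex ^ 4 \<Rightarrow> real ^ 4 \<Rightarrow> (complex ^ 4) set" where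
  "zero_level X l = {z. \<forall>\<xi>\<in>lie_N X. Psi X l z \<xi> = 0}"

definition N_class :: "complex set \<Rightarrow> complex ^ 4 \<Rightarrow> complex ^ 4 \<Rightarrow> (complex ^ 4) set" where
  "N_class L X z = {t * z | t. t \<in> group_N L X}"

definition quotient_topology :: "'a topology \<Rightarrow> ('a \<Rightarrow> 'b) \<Rightarrow> 'b topology" where
  "quotient_topology T q =
     topology (\<lambda>U. U \<subseteq> q ` topspace T \<and> openin T {x \<in> topspace T. q x \<in> U})"

lemma openin_quotient_topology:
  "openin (quotient_topology T q) U \<longleftrightarrow>
     U \<subseteq> q ` topspace T \<and> openin T {x \<in> topspace T. q x \<in> U}"
proof -
  have "istopology (\<lambda>U. U \<subseteq> q ` topspace T \<and> openin T {x \<in> topspace T. q x \<in> U})"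
    unfolding istopology_def
  proof (intro conjI allI impI)
    fix S S' assume S: "S \<subseteq> q ` topspace T \<and> openin T {x \<in> topspace T. q x \<in> S}"
      and S': "S' \<subseteq> q ` topspace T \<and> openin T {x \<in> topspace T. q x \<in> S'}"
    show "S \<inter> S' \<subseteq> q ` topspace T" using S by blast
    have "{x \<in> topspace T. q x \<in> S \<inter> S'} =
            {x \<in> topspace T. q x \<in> S} \<inter> {x \<in> topspace T. q x \<in> S'}" by blast
    then show "openin T {x \<in> topspace T. q x \<in> S \<inter> S'}" using S S' by auto
  next
    fix \<K> assume K: "\<forall>S\<in>\<K>. S \<subseteq> q ` topspace T \<and> openin T {x \<in> topspace T. q x \<in> S}"
    then show "\<Union>\<K> \<subseteq> q ` topspace T" by blast
    have "{x \<in> topspace T. q x \<in> \<Union>\<K>} = (\<Union>S\<in>\<K>. {x \<in> topspace T. q x \<in> S})" by blast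
    then show "openin T {x \<in> topspace T. q x \<in> \<Union>\<K>}" using K by auto
  qed
  then show ?thesis by (simp add: quotient_topology_def)
qed

text \<open>A chart consists of an open subset \<open>model\<close> of \<open>C^2\<close>, a discrete group \<open>grp\<close> acting on it by
  \<open>action\<close>, the homeomorphism \<open>homeo\<close> from the space of orbits onto an open part of the quasifold
  (orbits being represented as subsets of \<open>model\<close>), and the symplectic form \<open>form\<close>, given as a
  function of a point and two tangent vectors. The records hold these data only; that they are
  as described is part of the generalized Delzant theorem.\<close>

record ('g, 'p) symplectic_chart =
  model :: "(complex \<times> complex) set"
  grp :: "'g set"
  action :: "'g \<Rightarrow> complex \<times> complex \<Rightarrow> complex \<times> complex"
  homeo :: "(complex \<times> complex) set \<Rightarrow> 'p"
  form :: "complex \<times> complex \<Rightarrow> complex \<times> complex \<Rightarrow> complex \<times> complex \<Rightarrow> real"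

record ('g, 'p) symplectic_quasifold =
  carrier_top :: "'p topology"
  atlas :: "('g, 'p) symplectic_chart set"

definition orbit_space :: "'g set \<Rightarrow> ('g \<Rightarrow> 'a \<Rightarrow> 'a) \<Rightarrow> 'a set \<Rightarrow> 'a set set" where
  "orbit_space H a U = {{a g x | g. g \<in> H} | x. x \<in> U}"

text \<open>\<open>chart_point X l i j (u, w)\<close> is the point of the level set with \<open>i\<close>-th and \<open>j\<close>-th
  coordinates \<open>u\<close> and \<open>w\<close> whose other two coordinates are positive reals.\<close>

definition is_chart_point ::
    "complex ^ 4 \<Rightarrow> real ^ 4 \<Rightarrow> 4 \<Rightarrow> 4 \<Rightarrow> complex \<times> complex \<Rightarrow> complex ^ 4 \<Rightarrow> bool" where
  "is_chart_point X l i j p z \<longleftrightarrow>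
     z \<in> zero_level X l \<and> z $ i = fst p \<and> z $ j = snd p \<and>
     (\<forall>k. k \<noteq> i \<and> k \<noteq> j \<longrightarrow> (\<exists>r>0. z $ k = complex_of_real r))"

definition chart_point ::
    "complex ^ 4 \<Rightarrow> real ^ 4 \<Rightarrow> 4 \<Rightarrow> 4 \<Rightarrow> complex \<times> complex \<Rightarrow> complex ^ 4" where
  "chart_point X l i j p = (THE z. is_chart_point X l i j p z)"

definition chart_dom :: "complex ^ 4 \<Rightarrow> real ^ 4 \<Rightarrow> 4 \<Rightarrow> 4 \<Rightarrow> (complex \<times> complex) set" where
  "chart_dom X l i j = {p. \<exists>z. is_chart_point X l i j p z}"

definition chart_group :: "complex set \<Rightarrow> complex ^ 4 \<Rightarrow> 4 \<Rightarrow> 4 \<Rightarrow> (complex ^ 4) set" where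
  "chart_group L X i j = {g \<in> group_N L X. \<forall>k. k \<noteq> i \<and> k \<noteq> j \<longrightarrow> g $ k = 1}"

definition chart_action :: "4 \<Rightarrow> 4 \<Rightarrow> complex ^ 4 \<Rightarrow> complex \<times> complex \<Rightarrow> complex \<times> complex" where
  "chart_action i j g p = (g $ i * fst p, g $ j * snd p)"

text \<open>\<open>(1/(2 pi i)) (dz \<and> d\<bar>z + dw \<and> d\<bar>w)\<close>, where
  \<open>(\<alpha> \<and> \<beta>)(a, b) = \<alpha>(a) \<beta>(b) - \<alpha>(b) \<beta>(a)\<close>; its values are real.\<close>

definition standard_form :: "complex \<times> complex \<Rightarrow> complex \<times> complex \<Rightarrow> real" where
  "standard_form a b =
     Re (1 / (2 * pi * \<i>) *
       ((fst a * cnj (fst b) - fst b * cnj (fst a)) + (snd a * cnj (snd b) - snd b * cnj (snd a))))"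

definition delzant_chart ::
    "complex set \<Rightarrow> complex ^ 4 \<Rightarrow> real ^ 4 \<Rightarrow> 4 \<Rightarrow> 4 \<Rightarrow>
       (complex ^ 4, (complex ^ 4) set) symplectic_chart" where
  "delzant_chart L X l i j =
     \<lparr> model = chart_dom X l i j,
       grp = chart_group L X i j,
       action = chart_action i j,
       homeo = (\<lambda>C \<in> orbit_space (chart_group L X i j) (chart_action i j) (chart_dom X l i j).
                  the_elem ((\<lambda>p. N_class L X (chart_point X l i j p)) ` C)),
       form = (\<lambda>p \<in> chart_dom X l i j. standard_form) \<rparr>"

text \<open>Pairs of indices whose edges meet in a vertex of the polygon; listing the pairs in increasing
  order fixes the order of the two coordinates of each chart.\<close>

definition vertex_pairs :: "complex set \<Rightarrow> complex ^ 4 \<Rightarrow> real ^ 4 \<Rightarrow> (4 \<times> 4) set" where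
  "vertex_pairs D X l =
     {(i, j) \<in> {(1,2), (1,3), (1,4), (2,3), (2,4), (3,4)}.
        \<exists>v. v extreme_point_of D \<and>
            {\<mu> \<in> D. \<mu> \<bullet> (X $ i) = l $ i} \<inter> {\<mu> \<in> D. \<mu> \<bullet> (X $ j) = l $ j} = {v}}"

definition delzant ::
    "complex set \<Rightarrow> complex ^ 4 \<Rightarrow> complex set \<Rightarrow>
       (complex ^ 4, (complex ^ 4) set) symplectic_quasifold" where
  "delzant L X D =
     (let l = support_numbers D X in
       \<lparr> carrier_top = quotient_topology (top_of_set (zero_level X l)) (N_class L X),
         atlas = {delzant_chart L X l i j | i j. (i, j) \<in> vertex_pairs D X l} \<rparr>)"

definition kite_quasifold ::
    "complex set \<Rightarrow> (complex ^ 4, (complex ^ 4) set) symplectic_quasifold" where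
  "kite_quasifold D = delzant Q (kite_normals D) D"

definition M0_plus :: "(complex ^ 4, (complex ^ 4) set) symplectic_quasifold" where
  "M0_plus = delzant Q (vector [- Y 1, Y 2, - Y 3, Y 4]) (Delta_plus 0)"

end

theory Submission
  imports Defs
begin

text \<open>The Delzant construction sees a polygon only through its normals and its support numbers. Move a
  polygon by \<open>x \<mapsto> v + \<rho> x\<close>, where \<open>\<rho>\<close> has modulus \<open>1\<close>, and multiply its normals by \<open>\<rho>\<close>. This
  composes the map \<^const>\<open>normal_map\<close> with the multiplication by \<open>\<rho>\<close>, so its kernel is the same as
  before, and the group \<open>N\<close> is the same provided that \<open>\<rho>\<close> maps the quasilattice onto itself. The
  vector of support numbers changes by a vector in the image of the transpose of
  \<^const>\<open>normal_map\<close>, which pairs to zero with that kernel, so \<^const>\<open>Psi\<close> is the same. The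
  same pairs of edges meet in vertices, and nothing else enters the construction: the two
  quasifolds are not merely isomorphic but equal (\<open>delzant_sim\<close>). What is left is to find, for each kite of the tiling, such a motion with
  \<open>\<rho> = \<plusminus> Y k\<close> which carries \<open>\<Delta>\<^sub>0\<^sup>+\<close> to the kite and the normals of \<open>\<Delta>\<^sub>0\<^sup>+\<close> to those of the kite.

  A kite and a dart are both determined by their axis. Each edge makes an angle with the axis that
  is a multiple of \<open>pi / 5\<close>, so the tenth power of the unit vector along an edge is an invariant of
  the tile, and tiles with a common edge have the same invariant. To propagate the invariant through
  the whole tiling, split the tiles into those with a given invariant and the others. Both unions
  are closed, as only finitely many tiles meet a bounded set; they cover the plane; and they can
  meet only in vertices, as the tiling is edge-to-edge. The plane without the countably many vertices
  is connected, so one of the two classes is empty (\<open>same_direction\<close>). By the normalization the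
  invariant is \<open>-1\<close>, which forces the axis of every kite to be one of the ten vectors
  \<open>\<plusminus> Ystar k\<close>. The normals attached to a kite depend on its region alone, since the distances
  between the extreme points of the region reveal which of them are \<open>E\<close> and \<open>A\<close>
  (\<open>kite_axis_unique\<close>).

  The level set is the image of the product of the kite and a cube of phases under a continuous map
  (\<open>zero_level_image\<close>), so it is compact and connected, and so is its quotient.\<close>

section \<open>Trigonometry of the regular pentagon\<close>

lemma golden_gt_1: "golden > 1"
  unfolding golden_def using real_less_rsqrt[of 1 5] by simp

lemma golden_sq: "golden\<^sup>2 = golden + 1"
  unfolding golden_def by (simp add: power2_eq_square field_simps)

lemma inverse_golden: "1 / golden = golden - 1"
  using golden_sq golden_gt_1 by (simp add: field_simps power2_eq_square)

lemma cos_pi_5: "cos (pi / 5) = golden / 2"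
proof -
  define x where "x = cos (pi / 5)"
  have x0: "x > 0" unfolding x_def by (rule cos_gt_zero) auto
  have c2: "cos (2 * (pi / 5)) = 2 * x\<^sup>2 - 1" unfolding x_def by (rule cos_double_cos)
  have c3: "cos (3 * (pi / 5)) = 4 * x ^ 3 - 3 * x" unfolding x_def by (rule cos_treble_cos)
  \<comment> \<open>the angles \<open>2 pi / 5\<close> and \<open>3 pi / 5\<close> are supplementary\<close>
  have "3 * (pi / 5) = pi - 2 * (pi / 5)" by simp
  then have "cos (3 * (pi / 5)) = - cos (2 * (pi / 5))" by (simp only: cos_pi_minus)
  then have "4 * x ^ 3 - 3 * x = - (2 * x\<^sup>2 - 1)" using c2 c3 by simp
  then have "(x + 1) * (4 * x\<^sup>2 - 2 * x - 1) = 0"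
    by (simp add: algebra_simps power2_eq_square power3_eq_cube)
  then have "4 * x\<^sup>2 - 2 * x - 1 = 0" using x0 by simp
  then have "(2 * x - golden) * (2 * x + golden - 1) = 0"
    using golden_sq by (simp add: algebra_simps power2_eq_square)
  then have "2 * x = golden" using x0 golden_gt_1 by auto
  then show ?thesis by (simp add: x_def)
qed

lemma sin_pi_5_pos: "sin (pi / 5) > 0"
  by (rule sin_gt_zero) auto

lemma sin_2pi_5: "sin (2 * pi / 5) = golden * sin (pi / 5)"
  using sin_double[of "pi / 5"] by (simp add: cos_pi_5)

lemma cos_2pi_5: "cos (2 * pi / 5) = (golden - 1) / 2"
  using cos_double_cos[of "pi / 5"] golden_sq by (simp add: cos_pi_5 power2_eq_square field_simps)

lemma cis_pi_5_add_cis_minus: "cis (pi / 5) + cis (- (pi / 5)) = of_real golden"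
  by (simp add: complex_eq_iff cos_pi_5)

text \<open>The isosceles triangle with legs \<open>1\<close> and apex angle \<open>pi / 5\<close>, half of a kite, has base
  \<open>1 / golden\<close>.\<close>

lemma cis_pi_5_minus_one: "cis (pi / 5) - 1 = cis (3 * pi / 5) / of_real golden"
proof -
  have c: "cos (3 * pi / 5) = - ((golden - 1) / 2)" "sin (3 * pi / 5) = golden * sin (pi / 5)"
    using cos_2pi_5 sin_2pi_5 cos_pi_minus[of "2 * pi / 5"] sin_pi_minus[of "2 * pi / 5"]
    by (simp_all add: field_simps)
  have "golden / 2 - 1 = - ((golden - 1) / 2) / golden"
    using golden_gt_1 golden_sq by (simp add: field_simps power2_eq_square)
  then show ?thesis
    using golden_gt_1 by (simp add: complex_eq_iff c cos_pi_5 Re_divide_of_real Im_divide_of_real)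
qed

lemma cis_minus_pi_5_minus_one: "cis (- (pi / 5)) - 1 = cis (- (3 * pi / 5)) / of_real golden"
  using arg_cong[OF cis_pi_5_minus_one, of cnj] by (simp add: cis_cnj)

section \<open>Kites and darts in terms of their axes\<close>

lemma interior_angleD:
  assumes "interior_angle P V S = t" "S \<noteq> V"
  shows "P - V = of_real (dist P V / dist S V) * cis t * (S - V)"
proof -
  have "(P - V) / (S - V) = of_real (cmod ((P - V) / (S - V))) * cis t"
    using assms(1) Arg2pi_eq[of "(P - V) / (S - V)"] by (simp add: interior_angle_def cis_conv_exp)
  then show ?thesis using assms(2) by (simp add: field_simps norm_divide dist_norm)
qed

lemma interior_angleI:
  assumes "P - V = of_real r * cis t * (S - V)" "r > 0" "S \<noteq> V" "0 \<le> t" "t < 2 * pi"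
  shows "interior_angle P V S = t"
  unfolding interior_angle_def
  by (rule Arg2pi_unique[of r]) (use assms in \<open>auto simp: cis_conv_exp\<close>)

text \<open>The axis \<open>A - E\<close> bisects the angle at \<open>E\<close> and cuts the kite into two congruent isosceles
  triangles; this determines the kite, and conversely yields all its lengths and angles.\<close>

lemma is_kite_iff:
  "is_kite E B A G \<longleftrightarrow>
     cmod (A - E) = 1 \<and> B = E + (A - E) * cis (- (pi / 5)) \<and> G = E + (A - E) * cis (pi / 5)"
proof
  assume K: "is_kite E B A G"
  then have d: "dist E B = 1" "dist E G = 1" "dist E A = 1" "dist A B = 1 / golden"
    and e: "interior_angle G E B = 2 * pi / 5" "interior_angle E B A = 2 * pi / 5"
    unfolding is_kite_def by auto
  have ne: "B \<noteq> E" "A \<noteq> B" using d golden_gt_1 by auto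
  have 1: "G - E = cis (2 * pi / 5) * (B - E)"
    using interior_angleD[OF e(1) ne(1)] d by (simp add: dist_commute)
  have "E - B = of_real golden * cis (2 * pi / 5) * (A - B)"
    using interior_angleD[OF e(2) ne(2)] d by (simp add: dist_commute)
  then have "cis (- (2 * pi / 5)) * (E - B)
      = of_real golden * (cis (- (2 * pi / 5)) * cis (2 * pi / 5)) * (A - B)"
    by (simp add: mult_ac)
  then have 2: "A - B = (E - B) * cis (- (2 * pi / 5)) / of_real golden"
    using golden_gt_1 by (simp add: cis_mult mult.commute)
  have "1 - cis (- (2 * pi / 5)) / of_real golden = cis (pi / 5)"
  proof -
    have "cis (3 * pi / 5) = - cis (- (2 * pi / 5))"
      using cis_mult[of pi "- (2 * pi / 5)"] by (simp add: field_simps)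
    then show ?thesis using cis_pi_5_minus_one by (simp add: algebra_simps)
  qed
  moreover have "A - E = (B - E) * (1 - cis (- (2 * pi / 5)) / of_real golden)"
    using 2 by (simp add: algebra_simps diff_divide_distrib)
  ultimately have "A - E = (B - E) * cis (pi / 5)" by simp
  then have "B - E = (A - E) * cis (- (pi / 5))" "G - E = (A - E) * cis (pi / 5)"
    using 1 by (simp_all add: cis_mult mult.assoc mult.commute[of _ "B - E"])
  then show "cmod (A - E) = 1 \<and> B = E + (A - E) * cis (- (pi / 5)) \<and> G = E + (A - E) * cis (pi / 5)"
    using d by (simp add: dist_norm norm_minus_commute algebra_simps)
next
  define w where "w = A - E"
  assume "cmod (A - E) = 1 \<and> B = E + (A - E) * cis (- (pi / 5)) \<and> G = E + (A - E) * cis (pi / 5)"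
  then have w: "cmod w = 1" and A: "A - E = w" and B: "B - E = w * cis (- (pi / 5))"
    and G: "G - E = w * cis (pi / 5)"
    by (simp_all add: w_def)
  have w0: "w \<noteq> 0" using w by auto
  have AB: "B - A = w * cis (- (3 * pi / 5)) / of_real golden"
    using cis_minus_pi_5_minus_one A B by (simp add: algebra_simps)
  have AG: "G - A = w * cis (3 * pi / 5) / of_real golden"
    using cis_pi_5_minus_one A G by (simp add: algebra_simps)
  have g: "cmod (of_real golden) = golden" "of_real golden \<noteq> (0 :: complex)" "golden > 0"
    using golden_gt_1 by auto
  have "dist B E = 1" "dist G E = 1" "dist A E = 1" "dist B A = 1 / golden" "dist G A = 1 / golden"
    using A B G AB AG w g by (simp_all add: dist_norm norm_mult norm_divide)
  then have d: "dist E B = 1" "dist E G = 1" "dist E A = 1"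
    "dist A B = 1 / golden" "dist A G = 1 / golden"
    by (simp_all add: dist_commute)
  have ne: "B \<noteq> E" "A \<noteq> B" "G \<noteq> A" "E \<noteq> G" using d g by auto
  have "interior_angle G E B = 2 * pi / 5"
    by (rule interior_angleI[of _ _ 1]) (use B G ne in \<open>auto simp: cis_mult mult.left_commute\<close>)
  moreover have "interior_angle E B A = 2 * pi / 5"
  proof (rule interior_angleI[of _ _ golden])
    have "E - B = - (w * cis (- (pi / 5)))" "A - B = - (w * cis (- (3 * pi / 5)) / of_real golden)"
      using B AB by (simp_all add: algebra_simps)
    then show "E - B = of_real golden * cis (2 * pi / 5) * (A - B)"
      using g by (simp add: cis_mult mult.left_commute)
  qed (use g ne in auto)
  moreover have "interior_angle B A G = 4 * pi / 5"
  proof (rule interior_angleI[of _ _ 1])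
    have "cis (4 * pi / 5) * cis (3 * pi / 5) = cis (- (3 * pi / 5) + 2 * pi)"
      by (simp add: cis_mult)
    also have "\<dots> = cis (- (3 * pi / 5))" by (subst cis_mult[symmetric]) simp
    finally show "B - A = of_real 1 * cis (4 * pi / 5) * (G - A)"
      using AB AG by (simp add: mult.left_commute)
  qed (use ne in auto)
  moreover have "interior_angle A G E = 2 * pi / 5"
  proof (rule interior_angleI[of _ _ "1 / golden"])
    have "A - G = - (w * cis (3 * pi / 5) / of_real golden)" "E - G = - (w * cis (pi / 5))"
      using G AG by (simp_all add: algebra_simps)
    then show "A - G = of_real (1 / golden) * cis (2 * pi / 5) * (E - G)"
      using g by (simp add: cis_mult mult.left_commute)
  qed (use g ne in auto)
  ultimately show "is_kite E B A G" using d unfolding is_kite_def by simp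
qed

text \<open>The axis of a dart has length \<open>1 / golden\<close>; \<open>w\<close> is the unit vector along it. The axis cuts the
  dart into two triangles with angles \<open>pi / 5\<close>, \<open>pi / 5\<close> and \<open>3 pi / 5\<close>.\<close>

lemma is_dart_axis:
  assumes "is_dart F B A G"
  obtains w where "cmod w = 1" "B = F + w * cis (- (pi / 5))" "A = F + w / of_real golden"
    "G = F + w * cis (pi / 5)"
proof -
  have d: "dist F B = 1" "dist F G = 1" "dist A B = 1 / golden"
    and e: "interior_angle G F B = 2 * pi / 5" "interior_angle F B A = pi / 5"
    using assms unfolding is_dart_def by auto
  have g: "of_real golden \<noteq> (0 :: complex)" using golden_gt_1 by auto
  have ne: "B \<noteq> F" "A \<noteq> B" using d golden_gt_1 by auto
  define w where "w = (B - F) * cis (pi / 5)"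
  have w: "cmod w = 1" using d by (simp add: w_def norm_mult dist_norm norm_minus_commute)
  have B: "B - F = w * cis (- (pi / 5))" by (simp add: w_def mult.assoc cis_mult)
  have "G - F = cis (2 * pi / 5) * (B - F)"
    using interior_angleD[OF e(1) ne(1)] d by (simp add: dist_commute)
  then have G: "G - F = w * cis (pi / 5)" by (simp add: B cis_mult mult.left_commute)
  have "F - B = of_real golden * cis (pi / 5) * (A - B)"
    using interior_angleD[OF e(2) ne(2)] d by (simp add: dist_commute)
  then have "cis (- (pi / 5)) * (F - B) = of_real golden * (cis (- (pi / 5)) * cis (pi / 5)) * (A - B)"
    by (simp add: mult_ac)
  then have 2: "A - B = (F - B) * cis (- (pi / 5)) / of_real golden"
    using g by (simp add: cis_mult mult.commute)
  have "A - F = (B - F) + (A - B)" by simp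
  also have "\<dots> = (B - F) * (of_real golden - cis (- (pi / 5))) / of_real golden"
    using g by (subst 2) (simp add: field_simps)
  also have "of_real golden - cis (- (pi / 5)) = cis (pi / 5)"
    using cis_pi_5_add_cis_minus by (simp add: algebra_simps)
  finally have "A - F = w / of_real golden" by (simp add: w_def)
  then show thesis using that[OF w] B G by (simp add: algebra_simps)
qed

section \<open>Tiles in oblique coordinates\<close>

definition lside :: "complex \<Rightarrow> complex" where
  "lside w = w * cis (- (pi / 5))"

definition rside :: "complex \<Rightarrow> complex" where
  "rside w = w * cis (pi / 5)"

text \<open>Kites and darts belong to one family of quadrilaterals, symmetric about an axis of direction \<open>w\<close>.
  In the oblique coordinates \<open>a\<close>, \<open>b\<close> along the two sides that start at \<open>F\<close>, such a quadrilateral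
  is a sublevel set of a function that is linear on each side of the axis. It is a kite for
  \<open>c = 1 / golden\<close>, a dart for \<open>c = golden\<close>, and convex if and only if \<open>c \<le> 1\<close>.\<close>

definition wedge :: "real \<Rightarrow> complex \<Rightarrow> complex \<Rightarrow> complex set" where
  "wedge c F w = {F + a *\<^sub>R lside w + b *\<^sub>R rside w | a b. 0 \<le> a \<and> 0 \<le> b \<and> max a b + c * min a b \<le> 1}"

definition wedge_tip :: "real \<Rightarrow> complex \<Rightarrow> complex \<Rightarrow> complex" where
  "wedge_tip c F w = F + (1 / (1 + c)) *\<^sub>R (lside w + rside w)"

definition wedge_edges :: "real \<Rightarrow> complex \<Rightarrow> complex \<Rightarrow> complex set set" where
  "wedge_edges c F w =
     {{F, F + lside w}, {F + lside w, wedge_tip c F w}, {wedge_tip c F w, F + rside w}, {F + rside w, F}}"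

lemma lside_add_rside: "lside w + rside w = of_real golden * w"
  using cis_pi_5_add_cis_minus by (simp add: lside_def rside_def distrib_left[symmetric] add.commute)

text \<open>One half of the quadrilateral: the half-plane \<open>b \<le> a\<close> is one side of the axis, and there
  \<open>max a b + c * min a b\<close> is \<open>a + c * b\<close>.\<close>

lemma triangle_in_frame:
  fixes F p q :: "'a :: real_vector"
  assumes "c > 0"
  shows "convex hull {F, F + p, F + (1 / (1 + c)) *\<^sub>R (p + q)} =
           {F + a *\<^sub>R p + b *\<^sub>R q | a b. 0 \<le> b \<and> b \<le> a \<and> a + c * b \<le> 1}" (is "?L = ?R")
proof
  show "?L \<subseteq> ?R"
  proof
    fix x assume "x \<in> ?L"
    then obtain u v where uv: "0 \<le> u" "0 \<le> v" "u + v \<le> 1"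
      and x: "x = F + u *\<^sub>R p + v *\<^sub>R ((1 / (1 + c)) *\<^sub>R (p + q))"
      unfolding convex_hull_3_alt by auto
    have "x = F + (u + v / (1 + c)) *\<^sub>R p + (v / (1 + c)) *\<^sub>R q"
      by (simp add: x algebra_simps)
    moreover have "v / (1 + c) + c * (v / (1 + c)) = (1 + c) * (v / (1 + c))"
      by (simp only: distrib_right mult_1)
    then have "v / (1 + c) + c * (v / (1 + c)) = v"
      using assms by simp
    then have "u + v / (1 + c) + c * (v / (1 + c)) \<le> 1" using uv by simp
    ultimately show "x \<in> ?R" using uv assms
      by (intro CollectI exI[of _ "u + v / (1 + c)"] exI[of _ "v / (1 + c)"]) auto
  qed
  show "?R \<subseteq> ?L"
  proof
    fix x assume "x \<in> ?R"
    then obtain a b where ab: "0 \<le> b" "b \<le> a" "a + c * b \<le> 1" and x: "x = F + a *\<^sub>R p + b *\<^sub>R q"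
      by auto
    have "1 + c \<noteq> 0" using assms by simp
    then have "((1 + c) * b) *\<^sub>R (F + (1 / (1 + c)) *\<^sub>R (p + q) - F) = b *\<^sub>R (p + q)"
      by simp
    then have "x = F + (a - b) *\<^sub>R (F + p - F) + ((1 + c) * b) *\<^sub>R (F + (1 / (1 + c)) *\<^sub>R (p + q) - F)"
      by (simp only: x) (simp add: algebra_simps)
    moreover have "0 \<le> a - b" "0 \<le> (1 + c) * b" "(a - b) + (1 + c) * b \<le> 1"
      using ab assms by (auto simp: algebra_simps)
    ultimately show "x \<in> ?L" unfolding convex_hull_3_alt by blast
  qed
qed

lemma wedge_eq_triangles:
  assumes "c > 0"
  shows "convex hull {F, F + lside w, wedge_tip c F w} \<union> convex hull {F, wedge_tip c F w, F + rside w}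
           = wedge c F w"
proof -
  have 1: "convex hull {F, F + lside w, wedge_tip c F w} =
      {F + a *\<^sub>R lside w + b *\<^sub>R rside w | a b. 0 \<le> b \<and> b \<le> a \<and> a + c * b \<le> 1}"
    unfolding wedge_tip_def by (rule triangle_in_frame[OF assms])
  have "convex hull {F, wedge_tip c F w, F + rside w} =
      {F + a *\<^sub>R rside w + b *\<^sub>R lside w | a b. 0 \<le> b \<and> b \<le> a \<and> a + c * b \<le> 1}"
    using triangle_in_frame[OF assms, of F "rside w" "lside w"]
    by (simp add: wedge_tip_def add.commute insert_commute)
  also have "\<dots> = {F + b *\<^sub>R lside w + a *\<^sub>R rside w | a b. 0 \<le> b \<and> b \<le> a \<and> a + c * b \<le> 1}"
    by (simp add: algebra_simps)
  finally have 2: "convex hull {F, wedge_tip c F w, F + rside w} =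
      {F + b *\<^sub>R lside w + a *\<^sub>R rside w | a b. 0 \<le> b \<and> b \<le> a \<and> a + c * b \<le> 1}" .
  show ?thesis
  proof (intro equalityI subsetI)
    fix x assume "x \<in> convex hull {F, F + lside w, wedge_tip c F w} \<union>
      convex hull {F, wedge_tip c F w, F + rside w}"
    then show "x \<in> wedge c F w"
    proof
      assume "x \<in> convex hull {F, F + lside w, wedge_tip c F w}"
      then obtain a b where "x = F + a *\<^sub>R lside w + b *\<^sub>R rside w" "0 \<le> b" "b \<le> a" "a + c * b \<le> 1"
        unfolding 1 by auto
      then show ?thesis unfolding wedge_def by (intro CollectI exI[of _ a] exI[of _ b]) auto
    next
      assume "x \<in> convex hull {F, wedge_tip c F w, F + rside w}"
      then obtain a b where "x = F + b *\<^sub>R lside w + a *\<^sub>R rside w" "0 \<le> b" "b \<le> a" "a + c * b \<le> 1"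
        unfolding 2 by auto
      then show ?thesis unfolding wedge_def by (intro CollectI exI[of _ b] exI[of _ a]) auto
    qed
  next
    fix x assume "x \<in> wedge c F w"
    then obtain a b where x: "x = F + a *\<^sub>R lside w + b *\<^sub>R rside w" and
      ab: "0 \<le> a" "0 \<le> b" "max a b + c * min a b \<le> 1" unfolding wedge_def by auto
    show "x \<in> convex hull {F, F + lside w, wedge_tip c F w} \<union>
      convex hull {F, wedge_tip c F w, F + rside w}"
    proof (cases "b \<le> a")
      case True
      then have "x \<in> convex hull {F, F + lside w, wedge_tip c F w}"
        unfolding 1 using x ab by auto
      then show ?thesis by simp
    next
      case False
      then have "x \<in> convex hull {F, wedge_tip c F w, F + rside w}"
        unfolding 2 using x ab by (intro CollectI exI[of _ b] exI[of _ a]) auto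
      then show ?thesis by simp
    qed
  qed
qed

text \<open>For \<open>c \<le> 1\<close> the function \<open>max a b + c * min a b\<close> is the larger one of its two linear pieces,
  hence convex.\<close>

lemma max_min_le_iff:
  fixes a b c :: real
  assumes "c \<le> 1"
  shows "max a b + c * min a b \<le> 1 \<longleftrightarrow> a + c * b \<le> 1 \<and> b + c * a \<le> 1"
proof -
  have "b \<le> a \<Longrightarrow> b + c * a \<le> a + c * b" for a b :: real
    using mult_left_mono[of b a "1 - c"] assms by (simp add: algebra_simps)
  from this[of a b] this[of b a] show ?thesis by (auto simp: max_def min_def)
qed

lemma convex_wedge:
  assumes "c \<le> 1"
  shows "convex (wedge c F w)"
proof (rule convexI)
  fix x y and u v :: real
  assume "x \<in> wedge c F w" "y \<in> wedge c F w" and uv: "0 \<le> u" "0 \<le> v" "u + v = 1"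
  then obtain a b a' b' where x: "x = F + a *\<^sub>R lside w + b *\<^sub>R rside w"
    and y: "y = F + a' *\<^sub>R lside w + b' *\<^sub>R rside w"
    and ab: "0 \<le> a" "0 \<le> b" "a + c * b \<le> 1" "b + c * a \<le> 1"
    and ab': "0 \<le> a'" "0 \<le> b'" "a' + c * b' \<le> 1" "b' + c * a' \<le> 1"
    unfolding wedge_def max_min_le_iff[OF assms] by auto
  have "u *\<^sub>R x + v *\<^sub>R y = (u + v) *\<^sub>R F + (u * a + v * a') *\<^sub>R lside w + (u * b + v * b') *\<^sub>R rside w"
    unfolding x y by (simp add: algebra_simps)
  moreover have "u * s + v * s' \<le> 1" if "s \<le> 1" "s' \<le> 1" for s s'
    using mult_left_mono[OF that(1) uv(1)] mult_left_mono[OF that(2) uv(2)] uv(3) by simp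
  from this[OF ab(3) ab'(3)] this[OF ab(4) ab'(4)]
  have "(u * a + v * a') + c * (u * b + v * b') \<le> 1" "(u * b + v * b') + c * (u * a + v * a') \<le> 1"
    by (simp_all add: algebra_simps)
  ultimately show "u *\<^sub>R x + v *\<^sub>R y \<in> wedge c F w"
    unfolding wedge_def max_min_le_iff[OF assms] using ab ab' uv
    by (intro CollectI exI[of _ "u * a + v * a'"] exI[of _ "u * b + v * b'"]) auto
qed

lemma wedge_eq_hull:
  assumes "0 < c" "c \<le> 1"
  shows "convex hull {F, F + lside w, wedge_tip c F w, F + rside w} = wedge c F w"
proof
  let ?S = "{F, F + lside w, wedge_tip c F w, F + rside w}"
  have "?S \<subseteq> convex hull {F, F + lside w, wedge_tip c F w} \<union> convex hull {F, wedge_tip c F w, F + rside w}"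
    by (auto simp: hull_inc)
  then show "convex hull ?S \<subseteq> wedge c F w"
    unfolding wedge_eq_triangles[OF assms(1)] by (rule hull_minimal) (rule convex_wedge[OF assms(2)])
  show "wedge c F w \<subseteq> convex hull ?S"
    unfolding wedge_eq_triangles[OF assms(1), symmetric] by (intro Un_least hull_mono) auto
qed

text \<open>The coordinates with respect to \<open>lside w\<close> and \<open>rside w\<close>: the component of \<open>z / w\<close> along the axis
  is \<open>cos (pi / 5)\<close> times their sum, and the component across the axis is \<open>sin (pi / 5)\<close> times
  their difference.\<close>

definition lcoord :: "complex \<Rightarrow> complex \<Rightarrow> real" where
  "lcoord w z = (Re (z / w) / cos (pi / 5) - Im (z / w) / sin (pi / 5)) / 2"

definition rcoord :: "complex \<Rightarrow> complex \<Rightarrow> real" where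
  "rcoord w z = (Re (z / w) / cos (pi / 5) + Im (z / w) / sin (pi / 5)) / 2"

lemma coords:
  assumes "w \<noteq> 0"
  shows "lcoord w z *\<^sub>R lside w + rcoord w z *\<^sub>R rside w = z"
proof -
  have "lcoord w z *\<^sub>R cis (- (pi / 5)) + rcoord w z *\<^sub>R cis (pi / 5) = z / w"
    using sin_pi_5_pos golden_gt_1
    by (simp add: complex_eq_iff lcoord_def rcoord_def cos_pi_5 field_simps)
  then have "w * (lcoord w z *\<^sub>R cis (- (pi / 5)) + rcoord w z *\<^sub>R cis (pi / 5)) = z"
    using assms by simp
  then show ?thesis by (simp add: lside_def rside_def distrib_left)
qed

lemma coords_combination:
  assumes "w \<noteq> 0"
  shows "lcoord w (a *\<^sub>R lside w + b *\<^sub>R rside w) = a" "rcoord w (a *\<^sub>R lside w + b *\<^sub>R rside w) = b"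
proof -
  have "(a *\<^sub>R lside w + b *\<^sub>R rside w) / w = a *\<^sub>R cis (- (pi / 5)) + b *\<^sub>R cis (pi / 5)"
    using assms by (simp add: lside_def rside_def field_simps)
  then show "lcoord w (a *\<^sub>R lside w + b *\<^sub>R rside w) = a" "rcoord w (a *\<^sub>R lside w + b *\<^sub>R rside w) = b"
    using sin_pi_5_pos golden_gt_1
    by (simp_all add: lcoord_def rcoord_def cos_pi_5 field_simps)
qed

lemma mem_wedge_iff:
  assumes "w \<noteq> 0"
  shows "z \<in> wedge c F w \<longleftrightarrow> 0 \<le> lcoord w (z - F) \<and> 0 \<le> rcoord w (z - F) \<and>
     max (lcoord w (z - F)) (rcoord w (z - F)) + c * min (lcoord w (z - F)) (rcoord w (z - F)) \<le> 1"
    (is "_ \<longleftrightarrow> ?P (lcoord w (z - F)) (rcoord w (z - F))")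
proof
  assume "z \<in> wedge c F w"
  then obtain a b where "z - F = a *\<^sub>R lside w + b *\<^sub>R rside w" "?P a b" unfolding wedge_def by auto
  then show "?P (lcoord w (z - F)) (rcoord w (z - F))" by (simp add: coords_combination[OF assms])
next
  assume P: "?P (lcoord w (z - F)) (rcoord w (z - F))"
  have "z = F + lcoord w (z - F) *\<^sub>R lside w + rcoord w (z - F) *\<^sub>R rside w"
    using coords[OF assms, of "z - F"] by (simp add: algebra_simps)
  then show "z \<in> wedge c F w" unfolding wedge_def using P by blast
qed

definition wedge_core :: "real \<Rightarrow> complex \<Rightarrow> complex \<Rightarrow> complex set" where
  "wedge_core c F w = {z. 0 < lcoord w (z - F) \<and> 0 < rcoord w (z - F) \<and>
     max (lcoord w (z - F)) (rcoord w (z - F)) + c * min (lcoord w (z - F)) (rcoord w (z - F)) < 1}"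

lemma open_wedge_core: "open (wedge_core c F w)"
proof -
  have "continuous_on UNIV (\<lambda>z. lcoord w (z - F))" "continuous_on UNIV (\<lambda>z. rcoord w (z - F))"
    unfolding lcoord_def rcoord_def divide_inverse by (intro continuous_intros)+
  then show ?thesis
    unfolding wedge_core_def
    by (intro open_Collect_conj open_Collect_less continuous_intros) auto
qed

lemma wedge_core_subset: "w \<noteq> 0 \<Longrightarrow> wedge_core c F w \<subseteq> wedge c F w"
  by (auto simp: mem_wedge_iff wedge_core_def)

text \<open>Outside the core one of the inequalities that define the wedge is an equality, and each of these
  equalities holds along an edge.\<close>

lemma wedge_boundary:
  assumes c: "c > 0" and w: "w \<noteq> 0" and z: "z \<in> wedge c F w" and nz: "z \<notin> wedge_core c F w"
  shows "\<exists>e\<in>wedge_edges c F w. z \<in> convex hull e"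
proof -
  define a where "a = lcoord w (z - F)"
  define b where "b = rcoord w (z - F)"
  have zab: "z = F + a *\<^sub>R lside w + b *\<^sub>R rside w"
    using coords[OF w, of "z - F"] by (simp add: a_def b_def algebra_simps)
  have ab: "0 \<le> a" "0 \<le> b" "max a b + c * min a b \<le> 1"
    using z by (auto simp: mem_wedge_iff[OF w] a_def b_def)
  have cm: "0 \<le> c * min a b" using ab c by simp
  have "a = 0 \<or> b = 0 \<or> max a b + c * min a b = 1"
    using nz ab unfolding wedge_core_def a_def b_def by force
  then consider "a = 0" | "b = 0" | "b \<le> a" "a + c * b = 1" | "a \<le> b" "b + c * a = 1"
    by (cases "b \<le> a") auto
  then show ?thesis
  proof cases
    case 1
    have "z = (1 - b) *\<^sub>R F + b *\<^sub>R (F + rside w)" by (simp add: zab 1 algebra_simps)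
    then have "z \<in> convex hull {F + rside w, F}" using ab cm 1
      by (subst insert_commute) (force simp: segment_convex_hull[symmetric] in_segment)
    then show ?thesis by (auto simp: wedge_edges_def)
  next
    case 2
    have "z = (1 - a) *\<^sub>R F + a *\<^sub>R (F + lside w)" by (simp add: zab 2 algebra_simps)
    then have "z \<in> convex hull {F, F + lside w}" using ab cm 2
      by (force simp: segment_convex_hull[symmetric] in_segment)
    then show ?thesis by (auto simp: wedge_edges_def)
  next
    case 3
    have "b * (1 + c) \<le> 1" using 3(1) 3(2)[symmetric] by (simp add: algebra_simps)
    moreover have "a = (1 - b * (1 + c)) + b" using 3(2) by (simp add: algebra_simps)
    then have z: "z = F + ((1 - b * (1 + c)) + b) *\<^sub>R lside w + b *\<^sub>R rside w"
      by (simp add: zab)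
    have "1 + c \<noteq> 0" using c by simp
    then have "(b * (1 + c)) *\<^sub>R wedge_tip c F w = (b * (1 + c)) *\<^sub>R F + b *\<^sub>R (lside w + rside w)"
      by (simp add: wedge_tip_def scaleR_right_distrib)
    then have "z = (1 - b * (1 + c)) *\<^sub>R (F + lside w) + (b * (1 + c)) *\<^sub>R wedge_tip c F w"
      unfolding z by (simp add: algebra_simps)
    ultimately have "z \<in> convex hull {F + lside w, wedge_tip c F w}" using ab c
      unfolding segment_convex_hull[symmetric] in_segment
      by (intro exI[of _ "b * (1 + c)"]) auto
    then show ?thesis by (auto simp: wedge_edges_def)
  next
    case 4
    have "a * (1 + c) \<le> 1" using 4(1) 4(2)[symmetric] by (simp add: algebra_simps)
    moreover have "b = (1 - a * (1 + c)) + a" using 4(2) by (simp add: algebra_simps)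
    then have z: "z = F + ((1 - a * (1 + c)) + a) *\<^sub>R rside w + a *\<^sub>R lside w"
      by (simp add: zab)
    have "1 + c \<noteq> 0" using c by simp
    then have "(a * (1 + c)) *\<^sub>R wedge_tip c F w = (a * (1 + c)) *\<^sub>R F + a *\<^sub>R (lside w + rside w)"
      by (simp add: wedge_tip_def scaleR_right_distrib)
    then have "z = (1 - a * (1 + c)) *\<^sub>R (F + rside w) + (a * (1 + c)) *\<^sub>R wedge_tip c F w"
      unfolding z by (simp add: algebra_simps)
    ultimately have "z \<in> convex hull {F + rside w, wedge_tip c F w}" using ab c
      unfolding segment_convex_hull[symmetric] in_segment
      by (intro exI[of _ "a * (1 + c)"]) auto
    then show ?thesis by (auto simp: wedge_edges_def insert_commute)
  qed
qed

text \<open>Shrinking towards \<open>F\<close> by a factor \<open>1 - t\<close> makes the last inequality strict; a subsequent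
  move along the axis, of a length proportional to \<open>t\<close>, makes both coordinates positive.\<close>

lemma wedge_core_dense:
  assumes c: "c > 0" and w: "w \<noteq> 0" and z: "z \<in> wedge c F w" and U: "open U" "z \<in> U"
  shows "U \<inter> wedge_core c F w \<noteq> {}"
proof -
  define a where "a = lcoord w (z - F)"
  define b where "b = rcoord w (z - F)"
  have zab: "z = F + a *\<^sub>R lside w + b *\<^sub>R rside w"
    using coords[OF w, of "z - F"] by (simp add: a_def b_def algebra_simps)
  have ab: "0 \<le> a" "0 \<le> b" "max a b + c * min a b \<le> 1"
    using z by (auto simp: mem_wedge_iff[OF w] a_def b_def)
  \<comment> \<open>chosen such that the move along the axis uses up only half of the room gained by shrinking\<close>
  define d where "d = 1 / (2 * (1 + c))"
  have d: "d > 0" "d + c * d = 1 / 2" using c by (auto simp: d_def field_simps)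
  define g where "g t = F + ((1 - t) * a + t * d) *\<^sub>R lside w + ((1 - t) * b + t * d) *\<^sub>R rside w" for t
  have "(g \<longlongrightarrow> g 0) (at_right 0)" unfolding g_def by (intro tendsto_intros)
  then have "\<forall>\<^sub>F t in at_right 0. g t \<in> U"
    using U by (auto simp: tendsto_def g_def zab)
  moreover have "\<forall>\<^sub>F t in at_right 0. t > 0 \<and> t < (1::real)"
    using eventually_at_right[of 0 "1::real"] by (intro eventually_at_rightI[of _ 1]) auto
  ultimately have "\<forall>\<^sub>F t in at_right 0. g t \<in> U \<and> t > 0 \<and> t < 1" by eventually_elim auto
  then obtain t where t: "g t \<in> U" "0 < t" "t < 1"
    using eventually_happens'[OF trivial_limit_at_right_real] by blast
  have gt: "lcoord w (g t - F) = (1 - t) * a + t * d" "rcoord w (g t - F) = (1 - t) * b + t * d"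
    by (simp_all add: g_def add.assoc coords_combination[OF w])
  have mm: "max ((1 - t) * a + t * d) ((1 - t) * b + t * d) = (1 - t) * max a b + t * d"
    "min ((1 - t) * a + t * d) ((1 - t) * b + t * d) = (1 - t) * min a b + t * d"
    using t by (simp_all add: max_add_distrib_left min_add_distrib_left max_mult_distrib_left
      min_mult_distrib_left)
  have "((1 - t) * max a b + t * d) + c * ((1 - t) * min a b + t * d)
      = (1 - t) * (max a b + c * min a b) + t * (d + c * d)"
    by (simp add: algebra_simps)
  also have "\<dots> \<le> (1 - t) * 1 + t * (1 / 2)"
    unfolding d(2) using ab(3) t by (intro add_right_mono mult_left_mono) auto
  also have "\<dots> < 1" using t by simp
  finally have "g t \<in> wedge_core c F w"
    unfolding wedge_core_def mem_Collect_eq gt mm using ab t d by (auto intro!: add_nonneg_pos)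
  then show ?thesis using t by auto
qed

lemma lcoord_rotate: "w \<noteq> 0 \<Longrightarrow> lcoord w (w * z) = lcoord 1 z"
  and rcoord_rotate: "w \<noteq> 0 \<Longrightarrow> rcoord w (w * z) = rcoord 1 z"
  by (simp_all add: lcoord_def rcoord_def)

text \<open>The radius can be chosen independently of \<open>F\<close> and \<open>w\<close> because all wedges with the same \<open>c\<close> are
  congruent. This uniformity makes tilings locally finite.\<close>

lemma wedge_core_contains_ball:
  assumes "c > 0"
  shows "\<exists>r>0. \<exists>s. \<forall>F w. cmod w = 1 \<longrightarrow> ball (F + w * s) r \<subseteq> wedge_core c F w"
proof -
  have "0 \<in> wedge c 0 1" by (simp add: mem_wedge_iff lcoord_def rcoord_def)
  then have "UNIV \<inter> wedge_core c 0 1 \<noteq> {}" by (intro wedge_core_dense assms) auto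
  then obtain s where s: "s \<in> wedge_core c 0 1" by auto
  then obtain r where r: "r > 0" "ball s r \<subseteq> wedge_core c 0 1"
    using open_wedge_core open_contains_ball by blast
  show ?thesis
  proof (intro exI[of _ r] exI[of _ s] conjI r(1) allI impI)
    fix F w :: complex assume w: "cmod w = 1"
    show "ball (F + w * s) r \<subseteq> wedge_core c F w"
    proof
      fix z assume "z \<in> ball (F + w * s) r"
      define y where "y = (z - F) / w"
      have w0: "w \<noteq> 0" using w by auto
      have zy: "z - F = w * y" using w0 by (simp add: y_def)
      have "dist (F + w * s) z = cmod (w * s - w * y)"
        using zy by (simp add: dist_norm algebra_simps)
      also have "\<dots> = dist s y" using w by (simp add: right_diff_distrib[symmetric] norm_mult dist_norm)
      finally have "y \<in> ball s r" using \<open>z \<in> ball (F + w * s) r\<close> by simp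
      then have "y \<in> wedge_core c 0 1" using r by auto
      then show "z \<in> wedge_core c F w"
        by (simp add: wedge_core_def zy lcoord_rotate rcoord_rotate w0)
    qed
  qed
qed

lemma wedge_bounded:
  assumes c: "c > 0" and w: "cmod w = 1" and z: "z \<in> wedge c F w"
  shows "dist z F \<le> 2"
proof -
  obtain a b where zab: "z = F + a *\<^sub>R lside w + b *\<^sub>R rside w"
    and ab: "0 \<le> a" "0 \<le> b" "max a b + c * min a b \<le> 1"
    using z unfolding wedge_def by auto
  have "0 \<le> c * min a b" using ab c by simp
  then have "a \<le> 1" "b \<le> 1" using ab by auto
  have "dist z F = cmod (a *\<^sub>R lside w + b *\<^sub>R rside w)" by (simp add: zab dist_norm algebra_simps)
  also have "\<dots> \<le> cmod (a *\<^sub>R lside w) + cmod (b *\<^sub>R rside w)" by (rule norm_triangle_ineq)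
  also have "\<dots> = a + b" using w ab by (simp add: lside_def rside_def norm_mult)
  finally show ?thesis using \<open>a \<le> 1\<close> \<open>b \<le> 1\<close> by simp
qed

section \<open>The direction of a tile\<close>

lemma cis_fifths_power_10: "cis (of_int k * pi / 5) ^ 10 = 1"
proof -
  have "cis (of_int k * pi / 5) ^ 10 = cis (real 10 * (of_int k * pi / 5))" by (rule Complex.DeMoivre)
  also have "real 10 * (of_int k * pi / 5) = 2 * pi * of_int k" by simp
  also have "cis (2 * pi * of_int k) = 1" by (rule cis_multiple_2pi) simp
  finally show ?thesis .
qed

lemma sgn_power_10:
  assumes "z = of_real r * (w * cis (of_int k * pi / 5))" "r > 0" "cmod w = 1"
  shows "sgn z ^ 10 = w ^ 10"
proof -
  have "sgn z = w * cis (of_int k * pi / 5)"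
    using assms by (simp add: sgn_mult sgn_eq norm_mult)
  then show ?thesis by (simp add: power_mult_distrib cis_fifths_power_10)
qed

text \<open>The triangle with sides \<open>1\<close> and \<open>1 / golden\<close> that enclose an angle \<open>pi / 5\<close>, half of a dart, is
  isosceles with legs \<open>1 / golden\<close>.\<close>

lemma cis_pi_5_minus_inverse_golden:
  "cis (pi / 5) - of_real (1 / golden) = cis (2 * pi / 5) / of_real golden"
proof -
  have "golden / 2 - 1 / golden = (golden - 1) / 2 / golden"
    using golden_gt_1 golden_sq by (simp add: field_simps power2_eq_square)
  then show ?thesis
    using golden_gt_1
    by (simp add: complex_eq_iff cos_pi_5 cos_2pi_5 sin_2pi_5 Re_divide_of_real Im_divide_of_real)
qed

text \<open>The tenth power identifies directions that differ by a multiple of \<open>pi / 5\<close>. Opposite directions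
  are among these, so the order of the endpoints of an edge does not matter.\<close>

definition tile_direction :: "complex \<Rightarrow> tile \<Rightarrow> bool" where
  "tile_direction d t \<longleftrightarrow> (\<forall>x y. {x, y} \<in> edges t \<longrightarrow> sgn (x - y) ^ 10 = d)"

lemma tile_directionI:
  assumes "edges t = {{a, b}, {b, c}, {c, e}, {e, a}}"
    and "sgn (b - a) ^ 10 = d" "sgn (b - c) ^ 10 = d" "sgn (e - c) ^ 10 = d" "sgn (e - a) ^ 10 = d"
  shows "tile_direction d t"
proof -
  have sym: "sgn (x - y) ^ 10 = sgn (y - x) ^ 10" for x y :: complex
    using sgn_minus[of "x - y"] by simp
  show ?thesis
    unfolding tile_direction_def assms(1)
    using assms(2-) sym[of a b] sym[of b c] sym[of c e] sym[of e a] by (auto simp: doubleton_eq_iff)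
qed

lemma direction_sides:
  assumes "cmod w = 1"
  shows "sgn (F + lside w - F) ^ 10 = w ^ 10" "sgn (F + rside w - F) ^ 10 = w ^ 10"
  using sgn_power_10[of _ 1 w "-1"] sgn_power_10[of _ 1 w 1] assms by (simp_all add: lside_def rside_def)

text \<open>The two edges at \<open>E\<close> make angles \<open>\<plusminus> pi / 5\<close> with the axis, and the edges from \<open>A\<close> to \<open>B\<close> and
  \<open>G\<close> make angles \<open>\<plusminus> 3 pi / 5\<close>; for a dart the corresponding angles are \<open>\<plusminus> pi / 5\<close> and
  \<open>\<plusminus> 2 pi / 5\<close>.\<close>

lemma kite_wedge:
  assumes "is_kite E B A G"
  shows "cmod (A - E) = 1" "region (Kite E B A G) = wedge (1 / golden) E (A - E)"
    "edges (Kite E B A G) = wedge_edges (1 / golden) E (A - E)"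
    "tile_direction ((A - E) ^ 10) (Kite E B A G)"
proof -
  let ?w = "A - E"
  show w: "cmod ?w = 1" using assms by (simp add: is_kite_iff)
  have B: "B = E + lside ?w" and G: "G = E + rside ?w"
    using assms by (auto simp: is_kite_iff lside_def rside_def)
  have "1 / (1 + 1 / golden) = 1 / golden" using golden_gt_1 by (simp add: inverse_golden)
  then have A: "wedge_tip (1 / golden) E ?w = A"
    using golden_gt_1 by (simp add: wedge_tip_def lside_add_rside scaleR_conv_of_real)
  show "region (Kite E B A G) = wedge (1 / golden) E ?w"
    using wedge_eq_hull[of "1 / golden" E ?w] golden_gt_1 by (simp add: A B[symmetric] G[symmetric])
  show e: "edges (Kite E B A G) = wedge_edges (1 / golden) E ?w"
    by (simp add: wedge_edges_def A B[symmetric] G[symmetric])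
  have "B - A = ?w * (cis (- (pi / 5)) - 1)" by (simp add: B lside_def algebra_simps)
  then have "B - A = of_real (1 / golden) * (?w * cis (of_int (-3) * pi / 5))"
    unfolding cis_minus_pi_5_minus_one by simp
  then have BA: "sgn (B - A) ^ 10 = ?w ^ 10" by (rule sgn_power_10) (use w golden_gt_1 in auto)
  have "G - A = ?w * (cis (pi / 5) - 1)" by (simp add: G rside_def algebra_simps)
  then have "G - A = of_real (1 / golden) * (?w * cis (of_int 3 * pi / 5))"
    unfolding cis_pi_5_minus_one by simp
  then have GA: "sgn (G - A) ^ 10 = ?w ^ 10" by (rule sgn_power_10) (use w golden_gt_1 in auto)
  show "tile_direction (?w ^ 10) (Kite E B A G)"
    using direction_sides[OF w, of E] BA GA
    by (intro tile_directionI[of _ E B A G]) (simp_all only: edges.simps B[symmetric] G[symmetric])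
qed

lemma dart_wedge:
  assumes "is_dart F B A G"
  obtains w where "cmod w = 1" "region (Dart F B A G) = wedge golden F w"
    "edges (Dart F B A G) = wedge_edges golden F w" "tile_direction (w ^ 10) (Dart F B A G)"
proof -
  obtain w where w: "cmod w = 1" and B: "B = F + lside w" and A: "A = F + w / of_real golden"
    and G: "G = F + rside w"
    using assms unfolding lside_def rside_def by (rule is_dart_axis)
  have "1 / (1 + golden) * golden = 1 / golden"
    using golden_gt_1 golden_sq by (simp add: field_simps power2_eq_square)
  then have "(1 / (1 + golden)) *\<^sub>R (of_real golden * w) = (1 / golden) *\<^sub>R w"
    by (simp only: scaleR_scaleR flip: scaleR_conv_of_real)
  then have tip: "wedge_tip golden F w = A"
    by (simp add: wedge_tip_def lside_add_rside A scaleR_conv_of_real)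
  have 1: "region (Dart F B A G) = wedge golden F w"
    using wedge_eq_triangles[of golden F w] golden_gt_1 by (simp add: tip B[symmetric] G[symmetric])
  have 2: "edges (Dart F B A G) = wedge_edges golden F w"
    by (simp add: wedge_edges_def tip B[symmetric] G[symmetric])
  have "B - A = w * cnj (cis (pi / 5) - of_real (1 / golden))"
    by (simp add: A B lside_def cis_cnj algebra_simps)
  then have "B - A = of_real (1 / golden) * (w * cis (of_int (-2) * pi / 5))"
    unfolding cis_pi_5_minus_inverse_golden by (simp add: cis_cnj)
  then have BA: "sgn (B - A) ^ 10 = w ^ 10" by (rule sgn_power_10) (use w golden_gt_1 in auto)
  have "G - A = w * (cis (pi / 5) - of_real (1 / golden))"
    by (simp add: A G rside_def algebra_simps)
  then have "G - A = of_real (1 / golden) * (w * cis (of_int 2 * pi / 5))"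
    unfolding cis_pi_5_minus_inverse_golden by simp
  then have GA: "sgn (G - A) ^ 10 = w ^ 10" by (rule sgn_power_10) (use w golden_gt_1 in auto)
  have 3: "tile_direction (w ^ 10) (Dart F B A G)"
    using direction_sides[OF w, of F] BA GA
    by (intro tile_directionI[of _ F B A G]) (simp_all only: edges.simps B[symmetric] G[symmetric])
  show thesis by (rule that[OF w 1 2 3])
qed

lemma valid_tile_wedge:
  assumes "valid_tile t"
  shows "\<exists>c F w. c \<in> {1 / golden, golden} \<and> cmod w = 1 \<and> region t = wedge c F w \<and>
    edges t = wedge_edges c F w \<and> tile_direction (w ^ 10) t"
proof (cases t)
  case (Kite E B A G)
  then have "is_kite E B A G" using assms by simp
  from kite_wedge[OF this] show ?thesis
    by (intro exI[of _ "1 / golden"] exI[of _ E] exI[of _ "A - E"]) (simp only: Kite insert_iff simp_thms)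
next
  case (Dart F B A G)
  then have "is_dart F B A G" using assms by simp
  then obtain w where "cmod w = 1" "region (Dart F B A G) = wedge golden F w"
    "edges (Dart F B A G) = wedge_edges golden F w" "tile_direction (w ^ 10) (Dart F B A G)"
    by (rule dart_wedge)
  then show ?thesis
    by (intro exI[of _ golden] exI[of _ F] exI[of _ w]) (simp only: Dart insert_iff simp_thms)
qed

lemma valid_tile_direction: "valid_tile t \<Longrightarrow> \<exists>d. tile_direction d t"
  using valid_tile_wedge[of t] by blast

text \<open>Two distinct tiles can only have boundary points in common, since a tile is the closure of its
  interior; by the following two lemmas such a point lies on an edge of each
  of the two tiles.\<close>

lemma tile_boundary:
  assumes "valid_tile t" "z \<in> region t" "z \<notin> interior (region t)"
  shows "\<exists>e\<in>edges t. z \<in> convex hull e"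
proof -
  obtain c F w where t: "c \<in> {1 / golden, golden}" "cmod w = 1" "region t = wedge c F w"
    "edges t = wedge_edges c F w" using valid_tile_wedge[OF assms(1)] by blast
  have c: "c > 0" "w \<noteq> 0" using t(1,2) golden_gt_1 by auto
  have "wedge_core c F w \<subseteq> interior (region t)"
    unfolding t(3) by (rule interior_maximal[OF wedge_core_subset[OF c(2)] open_wedge_core])
  then show ?thesis using wedge_boundary[OF c, of z F] assms t by auto
qed

lemma tile_interior_dense:
  assumes "valid_tile t" "z \<in> region t" "open U" "z \<in> U"
  shows "U \<inter> interior (region t) \<noteq> {}"
proof -
  obtain c F w where t: "c \<in> {1 / golden, golden}" "cmod w = 1" "region t = wedge c F w"
    using valid_tile_wedge[OF assms(1)] by blast
  have c: "c > 0" "w \<noteq> 0" using t(1,2) golden_gt_1 by auto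
  have "wedge_core c F w \<subseteq> interior (region t)"
    unfolding t(3) by (rule interior_maximal[OF wedge_core_subset[OF c(2)] open_wedge_core])
  moreover have "U \<inter> wedge_core c F w \<noteq> {}"
    using wedge_core_dense[OF c _ assms(3,4)] assms(2) t by simp
  ultimately show ?thesis by blast
qed

text \<open>Each tile has its own ball of a fixed radius, and bounded diameter; so a bounded set meets only
  finitely many tiles of a tiling.\<close>

lemma tile_size:
  "\<exists>r>0. \<forall>t. valid_tile t \<longrightarrow>
     (\<exists>m. ball m r \<subseteq> interior (region t) \<and> (\<forall>z\<in>region t. dist z m \<le> 4))"
proof -
  have g: "1 / golden > 0" "golden > 0" using golden_gt_1 by auto
  obtain r1 s1 where 1: "r1 > 0" "\<And>F w. cmod w = 1 \<Longrightarrow> ball (F + w * s1) r1 \<subseteq> wedge_core (1 / golden) F w"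
    using wedge_core_contains_ball[OF g(1)] by blast
  obtain r2 s2 where 2: "r2 > 0" "\<And>F w. cmod w = 1 \<Longrightarrow> ball (F + w * s2) r2 \<subseteq> wedge_core golden F w"
    using wedge_core_contains_ball[OF g(2)] by blast
  have r: "min r1 r2 > 0" using 1 2 by simp
  show ?thesis
  proof (rule exI[of _ "min r1 r2"], intro conjI r allI impI)
    fix t assume v: "valid_tile t"
    obtain c F w where t: "c \<in> {1 / golden, golden}" "cmod w = 1" "region t = wedge c F w"
      using valid_tile_wedge[OF v] by blast
    have c: "c > 0" "w \<noteq> 0" using t(1,2) g by auto
    have "\<exists>m. ball m (min r1 r2) \<subseteq> wedge_core c F w"
    proof (cases "c = golden")
      case True
      then have "ball (F + w * s2) (min r1 r2) \<subseteq> wedge_core c F w" using 2(2)[OF t(2), of F] by auto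
      then show ?thesis by blast
    next
      case False
      then have "c = 1 / golden" using t(1) by auto
      then have "ball (F + w * s1) (min r1 r2) \<subseteq> wedge_core c F w" using 1(2)[OF t(2), of F] by auto
      then show ?thesis by blast
    qed
    then obtain m where m: "ball m (min r1 r2) \<subseteq> wedge_core c F w" by blast
    then have "m \<in> wedge c F w" using r wedge_core_subset[OF c(2)] by (meson centre_in_ball subsetD)
    have "dist z m \<le> 4" if "z \<in> region t" for z
      using wedge_bounded[OF c(1) t(2) \<open>m \<in> wedge c F w\<close>] wedge_bounded[OF c(1) t(2), of z F] that t(3)
        dist_triangle2[of z m F] by simp
    moreover have "wedge_core c F w \<subseteq> interior (region t)"
      unfolding t(3) by (rule interior_maximal[OF wedge_core_subset[OF c(2)] open_wedge_core])
    ultimately show "\<exists>m. ball m (min r1 r2) \<subseteq> interior (region t) \<and> (\<forall>z\<in>region t. dist z m \<le> 4)"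
      using m by blast
  qed
qed

lemma closed_region: "closed (region t)"
  by (cases t) (auto intro!: compact_imp_closed compact_Un finite_imp_compact_convex_hull)

section \<open>All tiles of a tiling have the same direction\<close>

lemma finite_tiles_near:
  assumes "\<forall>t\<in>T. valid_tile t" "tiling T"
  shows "finite {t \<in> T. region t \<inter> cball x R \<noteq> {}}"
proof -
  let ?S = "{t \<in> T. region t \<inter> cball x R \<noteq> {}}"
  obtain r where r: "r > 0"
    "\<forall>t. valid_tile t \<longrightarrow>
       (\<exists>m. ball m r \<subseteq> interior (region t) \<and> (\<forall>z\<in>region t. dist z m \<le> 4))"
    using tile_size by blast
  then obtain m where m: "\<And>t. valid_tile t \<Longrightarrow> ball (m t) r \<subseteq> interior (region t)"
    "\<And>t z. valid_tile t \<Longrightarrow> z \<in> region t \<Longrightarrow> dist z (m t) \<le> 4" by metis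
  \<comment> \<open>the centres \<open>m t\<close> of balls of radius \<open>r\<close> inside the tiles are uniformly separated\<close>
  have sep: "t = t'" if "t \<in> T" "t' \<in> T" "dist (m t) (m t') < r" for t t'
  proof (rule ccontr)
    assume "t \<noteq> t'"
    moreover have "m t' \<in> interior (region t)" "m t' \<in> interior (region t')"
      using m(1)[of t] m(1)[of t'] that assms(1) r(1) by auto
    ultimately show False using assms(2) that unfolding tiling_def by blast
  qed
  have "uniform_discrete (m ` ?S)" unfolding uniform_discrete_def using sep r(1) by blast
  moreover have "bounded (m ` ?S)"
  proof (rule bounded_subset[OF bounded_cball])
    have "m t \<in> cball x (R + 4)" if t: "t \<in> ?S" for t
    proof -
      obtain z where z: "z \<in> region t" "z \<in> cball x R" using t by blast
      then have "dist z (m t) \<le> 4" using m(2) assms(1) t by blast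
      then show ?thesis using z(2) dist_triangle[of x "m t" z] by simp
    qed
    then show "m ` ?S \<subseteq> cball x (R + 4)" by (rule image_subsetI)
  qed
  ultimately have "finite (m ` ?S)" using uniform_discrete_finite_iff by blast
  moreover have "inj_on m ?S"
    using sep r(1) by (intro inj_onI) (metis (no_types, lifting) dist_self mem_Collect_eq)
  ultimately show ?thesis by (rule finite_imageD)
qed

lemma closed_Union_tiles:
  assumes "\<forall>t\<in>T. valid_tile t" "tiling T" "S \<subseteq> T"
  shows "closed (\<Union>(region ` S))"
proof -
  have "locally_finite_in euclidean (region ` S)"
    unfolding locally_finite_in_def
  proof (intro conjI ballI)
    fix x :: complex
    have "{U \<in> region ` S. U \<inter> ball x 1 \<noteq> {}} \<subseteq> region ` {t \<in> T. region t \<inter> cball x 1 \<noteq> {}}"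
      using assms(3) ball_subset_cball[of x 1] by blast
    then have "finite {U \<in> region ` S. U \<inter> ball x 1 \<noteq> {}}"
      by (rule finite_subset) (intro finite_imageI finite_tiles_near assms)
    then show "\<exists>V. openin euclidean V \<and> x \<in> V \<and> finite {U \<in> region ` S. U \<inter> V \<noteq> {}}"
      by (intro exI[of _ "ball x 1"]) auto
  qed auto
  then have "closedin euclidean (\<Union>(region ` S))"
    by (intro closedin_locally_finite_Union) (auto simp: closed_region)
  then show ?thesis by simp
qed

lemma countable_tiles:
  assumes "\<forall>t\<in>T. valid_tile t" "tiling T"
  shows "countable T"
proof -
  have "T \<subseteq> (\<Union>n. {t \<in> T. region t \<inter> cball 0 (real n) \<noteq> {}})"
  proof
    fix t assume t: "t \<in> T"
    obtain z where z: "z \<in> region t"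
      by (cases t) (auto intro: hull_inc)
    obtain n where "cmod z \<le> real n" using real_arch_simple by blast
    then have "z \<in> cball 0 (real n)" by simp
    then show "t \<in> (\<Union>n. {t \<in> T. region t \<inter> cball 0 (real n) \<noteq> {}})" using t z by blast
  qed
  then show ?thesis
    by (rule countable_subset) (intro countable_UN countable_finite finite_tiles_near assms countableI_type)
qed

lemma finite_vertices: "finite (\<Union>(edges t))"
  by (cases t) auto

text \<open>Tiles that have an edge in common have the same direction. Hence, if \<open>S\<close> consists of the tiles
  of one direction, the union of \<open>S\<close> and the union of the remaining tiles are closed sets which
  cover the plane and can meet only in vertices. There are countably many vertices, and the
  plane minus a countable set is connected.\<close>

lemma same_direction:
  assumes T: "kite_dart_tiling T" and t0: "t0 \<in> T" "tile_direction d t0" and t1: "t1 \<in> T"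
  shows "tile_direction d t1"
proof (rule ccontr)
  assume nt1: "\<not> tile_direction d t1"
  have val: "\<forall>t\<in>T. valid_tile t" and til: "tiling T" and ee: "edge_to_edge T"
    using T by (auto simp: kite_dart_tiling_def)
  define S where "S = {t \<in> T. tile_direction d t}"
  define V where "V = (\<Union>t\<in>T. \<Union>(edges t))"
  have V: "countable V" unfolding V_def
    by (intro countable_UN countable_tiles val til countable_finite finite_vertices)
  have meet: "z \<in> V" if t: "t \<in> S" "t' \<in> T - S" and z: "z \<in> region t" "z \<in> region t'" for t t' z
  proof -
    have tt: "t \<in> T" "t' \<in> T" "t \<noteq> t'" using t by (auto simp: S_def)
    then have v: "valid_tile t" "valid_tile t'" using val by auto
    have disj: "interior (region t) \<inter> interior (region t') = {}"
      using til tt unfolding tiling_def by blast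
    have "z \<notin> interior (region t)"
      using tile_interior_dense[OF v(2) z(2) open_interior, of "region t"] disj by blast
    from tile_boundary[OF v(1) z(1) this] obtain e where e: "e \<in> edges t" "z \<in> convex hull e"
      by blast
    have "z \<notin> interior (region t')"
      using tile_interior_dense[OF v(1) z(1) open_interior, of "region t'"] disj by blast
    from tile_boundary[OF v(2) z(2) this] obtain e' where e': "e' \<in> edges t'" "z \<in> convex hull e'"
      by blast
    have "e \<noteq> e'"
    proof
      assume "e = e'"
      obtain d' where d': "tile_direction d' t'" using valid_tile_direction[OF v(2)] by blast
      obtain x y where xy: "e = {x, y}" using e(1) by (cases t) auto
      have "d = d'"
        using d' t(1) e(1) e'(1) \<open>e = e'\<close> xy unfolding tile_direction_def S_def by blast
      then show False using d' t by (auto simp: S_def)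
    qed
    then have "z \<in> e \<inter> e'" using ee e e' tt unfolding edge_to_edge_def by blast
    then show ?thesis using e tt by (auto simp: V_def)
  qed
  have not_in_V: "\<exists>z. z \<in> region t - V" if "t \<in> T" for t
  proof (rule ccontr)
    assume "\<not> ?thesis"
    then have "interior (region t) \<subseteq> V" using interior_subset by blast
    then have c: "countable (interior (region t))" using V countable_subset by blast
    obtain z where "z \<in> region t" by (cases t) (auto intro: hull_inc)
    then have "UNIV \<inter> interior (region t) \<noteq> {}"
      using val that by (intro tile_interior_dense[of t z UNIV]) auto
    then obtain y e where "e > 0" "ball y e \<subseteq> interior (region t)"
      using open_interior[of "region t"] unfolding open_contains_ball by blast
    then show False using c uncountable_ball[of e y] countable_subset by blast
  qed
  let ?P = "\<Union>(region ` S)" and ?N = "\<Union>(region ` (T - S))"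
  have "connected (- V)"
    using path_connected_complement_countable[OF _ V] by (simp add: path_connected_imp_connected)
  moreover have "closed ?P" "closed ?N"
    by (intro closed_Union_tiles[OF val til]; auto simp: S_def)+
  moreover have "?P \<inter> ?N \<inter> - V = {}" using meet by blast
  moreover have "- V \<subseteq> ?P \<union> ?N"
  proof -
    have "(\<Union>t\<in>T. region t) = UNIV" using til by (simp add: tiling_def)
    then show ?thesis by blast
  qed
  moreover have "?P \<inter> - V \<noteq> {}" using not_in_V[OF t0(1)] t0 by (auto simp: S_def)
  moreover have "?N \<inter> - V \<noteq> {}" using not_in_V[OF t1] t1 nt1 by (auto simp: S_def)
  ultimately show False unfolding connected_closed by blast
qed

text \<open>The edge at the origin has direction \<open>\<i>\<close>, whose tenth power is \<open>-1\<close>.\<close>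

lemma kite_axis_power_10:
  assumes T: "kite_dart_tiling T" "normalized_coordinates T" and K: "Kite E B A G \<in> T"
  shows "(A - E) ^ 10 = - 1"
proof -
  obtain t r where t: "t \<in> T" and r: "r > 0" "{0, r *\<^sub>R Ystar 0} \<in> edges t"
    using T(2) unfolding normalized_coordinates_def by auto
  have "valid_tile t" "is_kite E B A G" using T(1) t K by (auto simp: kite_dart_tiling_def)
  obtain d where d: "tile_direction d t" using valid_tile_direction[OF \<open>valid_tile t\<close>] by blast
  have "r *\<^sub>R Ystar 0 = of_real r * \<i>" by (simp add: complex_eq_iff Ystar_def)
  then have "sgn (0 - r *\<^sub>R Ystar 0) = - \<i>"
    using r(1) by (simp add: sgn_minus sgn_eq norm_mult)
  moreover have "sgn (0 - r *\<^sub>R Ystar 0) ^ 10 = d" using d r(2) unfolding tile_direction_def by blast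
  moreover have "(- \<i>) ^ 10 = (-1 :: complex)"
    using power_mult[of "\<i>" 2 5] by simp
  ultimately have "d = - 1" by simp
  then have "tile_direction (- 1) (Kite E B A G)" using same_direction[OF T(1) t d K] by simp
  moreover have "tile_direction ((A - E) ^ 10) (Kite E B A G)" by (rule kite_wedge[OF \<open>is_kite E B A G\<close>])
  moreover have "{E, B} \<in> edges (Kite E B A G)" by simp
  ultimately show ?thesis unfolding tile_direction_def by metis
qed

section \<open>The ten reference kites\<close>

lemma is_kite_of_axis:
  "cmod w = 1 \<Longrightarrow> is_kite E (E + lside w) (E + w) (E + rside w)"
  by (simp add: is_kite_iff lside_def rside_def)

lemma Y_eq_cis: "Y k = cis (2 * pi * real k / 5)"
  by (simp add: Y_def cis.code)

lemma Ystar_eq: "Ystar k = \<i> * Y k"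
  by (simp add: Ystar_def Y_def complex_eq_iff)

lemma Y_mult: "Y j * Y k = Y (j + k)"
  by (simp add: Y_eq_cis cis_mult algebra_simps add_divide_distrib)

lemma norm_Y [simp]: "cmod (Y k) = 1" and norm_Ystar [simp]: "cmod (Ystar k) = 1"
  by (simp_all add: Y_eq_cis Ystar_eq norm_mult)

lemma the_kite_region:
  assumes "cmod w = 1"
  shows "(THE K. \<exists>E B A G. is_kite E B A G \<and> E = 0 \<and> A - E = w \<and> K = region (Kite E B A G))
           = wedge (1 / golden) 0 w"
proof (rule the_equality)
  show "\<exists>E B A G. is_kite E B A G \<and> E = 0 \<and> A - E = w \<and> wedge (1 / golden) 0 w = region (Kite E B A G)"
    using is_kite_of_axis[OF assms, of 0] kite_wedge(2)[OF is_kite_of_axis[OF assms, of 0]] by auto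
next
  fix K assume "\<exists>E B A G. is_kite E B A G \<and> E = 0 \<and> A - E = w \<and> K = region (Kite E B A G)"
  then show "K = wedge (1 / golden) 0 w" using kite_wedge(2) by auto
qed

lemma Delta_plus_eq: "Delta_plus k = wedge (1 / golden) 0 (Ystar k)"
  unfolding Delta_plus_def by (rule the_kite_region) simp

lemma Delta_minus_eq: "Delta_minus k = wedge (1 / golden) 0 (- Ystar k)"
  unfolding Delta_minus_def by (rule the_kite_region) simp

lemma wedge_similarity: "(\<lambda>x. v + \<rho> * x) ` wedge c F w = wedge c (v + \<rho> * F) (\<rho> * w)"
proof -
  have "v + \<rho> * (F + a *\<^sub>R lside w + b *\<^sub>R rside w)
      = v + \<rho> * F + a *\<^sub>R lside (\<rho> * w) + b *\<^sub>R rside (\<rho> * w)" for a b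
    by (simp add: lside_def rside_def algebra_simps)
  then show ?thesis unfolding wedge_def by (auto simp: image_iff) metis+
qed

lemma fifth_root_of_unity:
  assumes "z ^ 5 = 1"
  shows "\<exists>k<5. z = Y k"
proof -
  have "z \<in> {z. z ^ 5 = 1}" using assms by simp
  also have "\<dots> = {exp (2 * of_real pi * \<i> * of_nat j / of_nat 5) | j. j < 5}"
    by (rule complex_roots_unity) simp
  finally obtain j where "j < 5" "z = exp (2 * of_real pi * \<i> * of_nat j / of_nat 5)" by blast
  then show ?thesis by (auto simp: Y_eq_cis cis_conv_exp mult_ac)
qed

text \<open>For \<open>w = \<i> z\<close> the equation says that \<open>z\<close> is a tenth root of unity; then \<open>z\<close> or \<open>- z\<close> is a fifth
  root of unity.\<close>

lemma power_10_eq_minus_1: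
  assumes "w ^ 10 = - 1"
  obtains k where "k < 5" "w = Ystar k \<or> w = - Ystar k"
proof -
  define z where "z = - (\<i> * w)"
  have w: "w = \<i> * z" by (simp add: z_def)
  have "\<i> ^ 10 = (-1 :: complex)" using power_mult[of "\<i>" 2 5] by simp
  then have "z ^ 10 = 1" using assms by (simp add: w power_mult_distrib)
  moreover have "(z ^ 5)\<^sup>2 = z ^ 10" by (simp flip: power_mult)
  ultimately have "z ^ 5 = 1 \<or> z ^ 5 = - 1" by (simp only: power2_eq_1_iff)
  then consider "z ^ 5 = 1" | "(- z) ^ 5 = 1" by auto
  then have "\<exists>k<5. z = Y k \<or> z = - Y k"
  proof cases
    case 1
    then show ?thesis using fifth_root_of_unity by blast
  next
    case 2
    then show ?thesis using fifth_root_of_unity by (metis minus_minus)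
  qed
  then show thesis using that by (auto simp: w Ystar_eq)
qed

section \<open>A kite determines its vertices\<close>

lemma extreme_point_of_unique_max:
  fixes f :: "'a :: real_vector \<Rightarrow> real"
  assumes "linear f" "x \<in> S" "\<And>y. y \<in> S \<Longrightarrow> y \<noteq> x \<Longrightarrow> f y < f x"
  shows "x extreme_point_of S"
  unfolding extreme_point_of_def
proof (intro conjI ballI notI)
  fix a b assume ab: "a \<in> S" "b \<in> S" and seg: "x \<in> open_segment a b"
  obtain u where u: "0 < u" "u < 1" and x: "x = (1 - u) *\<^sub>R a + u *\<^sub>R b"
    using seg unfolding in_segment by blast
  have ne: "a \<noteq> x" "b \<noteq> x" using seg by (auto simp: open_segment_def)
  have "f a < f x" "f b < f x" using assms(3) ab ne by auto
  then have "(1 - u) * f a + u * f b < (1 - u) * f x + u * f x"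
    using u by (intro add_strict_mono mult_strict_left_mono) auto
  moreover have "f x = (1 - u) * f a + u * f b"
    by (subst x) (simp add: linear_add[OF assms(1)] linear_scale[OF assms(1)])
  ultimately show False by (simp add: algebra_simps)
qed (use assms in auto)

lemma linear_coords: "linear (lcoord w)" "linear (rcoord w)"
proof -
  have "(x + y) / w = x / w + y / w" "(r *\<^sub>R x) / w = r *\<^sub>R (x / w)" for x y :: complex and r :: real
    by (simp_all add: add_divide_distrib scaleR_conv_of_real)
  then show "linear (lcoord w)" "linear (rcoord w)"
    by (auto intro!: linearI simp: lcoord_def rcoord_def add_divide_distrib diff_divide_distrib
        distrib_left right_diff_distrib)
qed

text \<open>Each of the four vertices is the only maximum of a suitable linear function
  \<open>p * a + q * b\<close> of the oblique coordinates.\<close>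

lemma extreme_points_wedge:
  assumes c: "0 < c" "c < 1" and w: "w \<noteq> 0"
  shows "{x. x extreme_point_of wedge c F w} = {F, F + lside w, wedge_tip c F w, F + rside w}"
proof
  show "{x. x extreme_point_of wedge c F w} \<subseteq> {F, F + lside w, wedge_tip c F w, F + rside w}"
    unfolding wedge_eq_hull[of c F w, symmetric, OF c(1) less_imp_le[OF c(2)]]
    by (rule extreme_points_of_convex_hull)
  have max: "F + a *\<^sub>R lside w + b *\<^sub>R rside w extreme_point_of wedge c F w"
    if ab: "0 \<le> a" "0 \<le> b" "a + c * b \<le> 1" "b + c * a \<le> 1" and
      gt: "\<And>a' b'. 0 \<le> a' \<Longrightarrow> 0 \<le> b' \<Longrightarrow> a' + c * b' \<le> 1 \<Longrightarrow> b' + c * a' \<le> 1 \<Longrightarrow>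
        (a', b') \<noteq> (a, b) \<Longrightarrow> p * a' + q * b' < p * a + q * b" for a b p q
  proof (rule extreme_point_of_unique_max)
    let ?f = "\<lambda>z. p * lcoord w z + q * rcoord w z"
    show f: "linear ?f"
      by (auto intro!: linearI simp: linear_add[OF linear_coords(1)] linear_add[OF linear_coords(2)]
          linear_scale[OF linear_coords(1)] linear_scale[OF linear_coords(2)] algebra_simps)
    show "F + a *\<^sub>R lside w + b *\<^sub>R rside w \<in> wedge c F w"
      using ab c unfolding wedge_def max_min_le_iff[OF less_imp_le[OF c(2)]] by blast
    fix y assume y: "y \<in> wedge c F w" "y \<noteq> F + a *\<^sub>R lside w + b *\<^sub>R rside w"
    then obtain a' b' where y': "y = F + a' *\<^sub>R lside w + b' *\<^sub>R rside w"
      and ab': "0 \<le> a'" "0 \<le> b'" "a' + c * b' \<le> 1" "b' + c * a' \<le> 1"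
      unfolding wedge_def max_min_le_iff[OF less_imp_le[OF c(2)]] by auto
    have val: "?f (F + s *\<^sub>R lside w + t *\<^sub>R rside w) = ?f F + (p * s + q * t)" for s t
    proof -
      have "?f (F + (s *\<^sub>R lside w + t *\<^sub>R rside w)) = ?f F + ?f (s *\<^sub>R lside w + t *\<^sub>R rside w)"
        by (rule linear_add[OF f])
      then show ?thesis by (simp only: coords_combination[OF w] add.assoc)
    qed
    show "?f y < ?f (F + a *\<^sub>R lside w + b *\<^sub>R rside w)"
      using gt[OF ab'] y(2) unfolding y' val by auto
  qed
  have "F extreme_point_of wedge c F w"
    using max[of 0 0 "-1" "-1"] c by force
  moreover have "F + lside w extreme_point_of wedge c F w"
  proof -
    have "a' < 1" if "0 \<le> a'" "0 \<le> b'" "a' + c * b' \<le> 1" "(a', b') \<noteq> (1, 0)" for a' b'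
    proof (cases "b' = 0")
      case False
      then have "c * b' > 0" using that c by simp
      then show ?thesis using that by linarith
    qed (use that in auto)
    then show ?thesis using max[of 1 0 1 0] c by simp
  qed
  moreover have "F + rside w extreme_point_of wedge c F w"
  proof -
    have "b' < 1" if "0 \<le> a'" "0 \<le> b'" "b' + c * a' \<le> 1" "(a', b') \<noteq> (0, 1)" for a' b'
    proof (cases "a' = 0")
      case False
      then have "c * a' > 0" using that c by simp
      then show ?thesis using that by linarith
    qed (use that in auto)
    then show ?thesis using max[of 0 1 0 1] c by simp
  qed
  moreover have "wedge_tip c F w extreme_point_of wedge c F w"
  proof -
    let ?s = "1 / (1 + c)"
    have s: "?s + c * ?s = 1" using c by (simp add: field_simps)
    have "a' + b' < ?s + ?s" if h: "a' + c * b' \<le> 1" "b' + c * a' \<le> 1" "(a', b') \<noteq> (?s, ?s)" for a' b'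
    proof (rule ccontr)
      assume "\<not> a' + b' < ?s + ?s"
      then have "(1 + c) * (?s + ?s) \<le> (1 + c) * (a' + b')" using c by (intro mult_left_mono) auto
      moreover have "(1 + c) * (?s + ?s) = (1 + c) * ?s + (1 + c) * ?s" by (rule distrib_left)
      moreover have "(1 + c) * ?s = 1" using c by simp
      moreover have "(1 + c) * (a' + b') = (a' + c * b') + (b' + c * a')" by (simp add: algebra_simps)
      ultimately have eq: "a' + c * b' = 1" "b' + c * a' = 1" using h by auto
      then have "(1 - c) * (a' - b') = 0" by (simp add: algebra_simps)
      then have "a' = b'" using c by simp
      then have "(1 + c) * a' = 1" using eq by (simp add: algebra_simps)
      then have "a' = ?s" using c by (simp add: field_simps)
      then show False using h \<open>a' = b'\<close> by simp
    qed
    then show ?thesis using max[of ?s ?s 1 1] c s by (simp add: wedge_tip_def scaleR_right_distrib add.assoc)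
  qed
  ultimately show "{F, F + lside w, wedge_tip c F w, F + rside w} \<subseteq> {x. x extreme_point_of wedge c F w}"
    by blast
qed

text \<open>Among the four vertices, \<open>E\<close> is the one at distance \<open>1\<close> from all the others, and \<open>A\<close> is the
  other one whose distances are at most \<open>1\<close>, since \<open>dist B G > 1\<close>.\<close>

lemma kite_vertices:
  assumes "is_kite E B A G"
  defines "S \<equiv> {E, B, A, G}"
  shows "{p \<in> S. \<forall>q\<in>S. q = p \<or> dist p q = 1} = {E}" "{p \<in> S. \<forall>q\<in>S. dist p q \<le> 1} = {E, A}"
proof -
  have d: "dist E B = 1" "dist E G = 1" "dist E A = 1" "dist A B = 1 / golden" "dist A G = 1 / golden"
    using assms(1) unfolding is_kite_def by auto
  have "dist B G = cmod ((A - E) * (cis (- (pi / 5)) - cis (pi / 5)))"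
    using assms(1) by (simp add: is_kite_iff dist_norm right_diff_distrib)
  also have "cis (- (pi / 5)) - cis (pi / 5) = of_real (- 2 * sin (pi / 5)) * \<i>"
    by (simp add: complex_eq_iff)
  finally have BG: "dist B G = 2 * sin (pi / 5)"
    using d sin_pi_5_pos by (simp add: norm_mult dist_norm norm_minus_commute)
  \<comment> \<open>\<open>4 sin\<^sup>2 (pi / 5) = 4 - golden\<^sup>2 = 3 - golden\<close>, which exceeds \<open>1\<close>\<close>
  have "golden < 2" using real_less_lsqrt[of 3 5] by (simp add: golden_def)
  then have "(2 * sin (pi / 5))\<^sup>2 > 1\<^sup>2"
    using sin_squared_eq[of "pi / 5"] golden_sq by (simp add: power_mult_distrib cos_pi_5 power_divide)
  then have "2 * sin (pi / 5) > 1" by (rule power_less_imp_less_base) (use sin_pi_5_pos in simp)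
  then have BG': "dist B G > 1" "dist G B > 1" using BG by (simp_all add: dist_commute)
  have g: "1 / golden < 1" using golden_gt_1 by simp
  have d': "dist B E = 1" "dist G E = 1" "dist A E = 1" "dist B A = 1 / golden" "dist G A = 1 / golden"
    using d by (simp_all add: dist_commute)
  have ne: "E \<noteq> B" "E \<noteq> G" "E \<noteq> A" "A \<noteq> B" "A \<noteq> G" "B \<noteq> G" using d BG' golden_gt_1 by auto
  show "{p \<in> S. \<forall>q\<in>S. q = p \<or> dist p q = 1} = {E}" "{p \<in> S. \<forall>q\<in>S. dist p q \<le> 1} = {E, A}"
    unfolding S_def using d d' BG' g ne by auto
qed

lemma kite_axis_unique:
  assumes eq: "wedge (1 / golden) E w = wedge (1 / golden) E' w'" and w: "cmod w = 1" "cmod w' = 1"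
  shows "w = w'"
proof -
  have c: "0 < 1 / golden" "1 / golden < 1" using golden_gt_1 by auto
  have "1 / (1 + 1 / golden) = 1 / golden" using golden_gt_1 by (simp add: inverse_golden)
  then have tip: "wedge_tip (1 / golden) E w = E + w" for E w
    using golden_gt_1 by (simp add: wedge_tip_def lside_add_rside scaleR_conv_of_real)
  have "{E, E + lside w, E + w, E + rside w} = {E', E' + lside w', E' + w', E' + rside w'}"
    using extreme_points_wedge[OF c, of w E] extreme_points_wedge[OF c, of w' E'] w eq
    by (simp add: tip) (metis norm_zero zero_neq_one)
  then have "{E} = {E'}" "{E, E + w} = {E', E' + w'}"
    using kite_vertices[OF is_kite_of_axis[OF w(1), of E]] kite_vertices[OF is_kite_of_axis[OF w(2), of E']]
    by simp_all
  then show "w = w'" by (auto simp: doubleton_eq_iff)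
qed

section \<open>Normals of a kite\<close>

abbreviation reference_normals :: "complex ^ 4" where
  "reference_normals \<equiv> vector [- Y 1, Y 2, - Y 3, Y 4]"

lemma vector_4:
  "(vector [x, y, z, t] :: 'a :: zero ^ 4) $ 1 = x" "(vector [x, y, z, t] :: 'a ^ 4) $ 2 = y"
  "(vector [x, y, z, t] :: 'a ^ 4) $ 3 = z" "(vector [x, y, z, t] :: 'a ^ 4) $ 4 = t"
  unfolding vector_def by simp_all

text \<open>Both choices of normals are the reference normals, rotated by \<open>Y k\<close> for a translate of
  \<open>\<Delta>\<^sub>k\<^sup>+\<close> and by \<open>- Y k\<close> for a translate of \<open>\<Delta>\<^sub>k\<^sup>-\<close>.\<close>

lemma rotated_normals:
  "vector [- Y (k + 1), Y (k + 2), - Y (k + 3), Y (k + 4)] = Y k *s reference_normals"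
  "vector [Y (k + 1), - Y (k + 2), Y (k + 3), - Y (k + 4)] = - Y k *s reference_normals"
  unfolding vec_eq_iff forall_4
  by (simp_all only: vector_4 vector_smult_component mult_minus_left mult_minus_right minus_minus
      Y_mult simp_thms)

text \<open>The definite description is justified because every way of writing a kite as a translate of a
  reference kite uses the same axis. The rotation by \<open>w / \<i>\<close> takes the axis \<open>\<i>\<close> of \<open>\<Delta>\<^sub>0\<^sup>+\<close> to
  the axis \<open>w\<close>.\<close>

lemma kite_normals_eq:
  assumes w: "w ^ 10 = - 1"
  shows "kite_normals (wedge (1 / golden) E w) = (w / \<i>) *s reference_normals"
proof -
  obtain k where k: "k < 5" "w = Ystar k \<or> w = - Ystar k" by (rule power_10_eq_minus_1[OF w])
  have w1: "cmod w = 1" using k by auto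
  have plus: "(+) v ` Delta_plus j = wedge (1 / golden) v (Ystar j)"
    and minus: "(+) v ` Delta_minus j = wedge (1 / golden) v (- Ystar j)" for v j
    using wedge_similarity[of v 1 "1 / golden" 0] by (simp_all add: Delta_plus_eq Delta_minus_eq)
  show ?thesis
    unfolding kite_normals_def rotated_normals plus minus
  proof (rule the_equality)
    show "\<exists>k<5. \<exists>v. wedge (1 / golden) E w = wedge (1 / golden) v (Ystar k) \<and>
          (w / \<i>) *s reference_normals = Y k *s reference_normals \<or>
        wedge (1 / golden) E w = wedge (1 / golden) v (- Ystar k) \<and>
          (w / \<i>) *s reference_normals = - Y k *s reference_normals"
      using k by (intro exI[of _ k] exI[of _ E]) (auto simp: Ystar_eq)
  next
    fix X assume "\<exists>k<5. \<exists>v. wedge (1 / golden) E w = wedge (1 / golden) v (Ystar k) \<and>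
          X = Y k *s reference_normals \<or>
        wedge (1 / golden) E w = wedge (1 / golden) v (- Ystar k) \<and> X = - Y k *s reference_normals"
    then obtain j v where "wedge (1 / golden) E w = wedge (1 / golden) v (Ystar j) \<and> X = Y j *s reference_normals \<or>
        wedge (1 / golden) E w = wedge (1 / golden) v (- Ystar j) \<and> X = - Y j *s reference_normals"
      by blast
    then have "w = Ystar j \<and> X = Y j *s reference_normals \<or> w = - Ystar j \<and> X = - Y j *s reference_normals"
      using kite_axis_unique w1 by (metis norm_Ystar norm_minus_cancel)
    then show "X = (w / \<i>) *s reference_normals" by (auto simp: Ystar_eq)
  qed
qed

section \<open>Support numbers\<close>

definition is_support :: "complex set \<Rightarrow> complex ^ 4 \<Rightarrow> real ^ 4 \<Rightarrow> bool" where
  "is_support D X l \<longleftrightarrow>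
     D = (\<Inter>j. {\<mu>. \<mu> \<bullet> (X $ j) \<ge> l $ j}) \<and> (\<forall>j. {\<mu> \<in> D. \<mu> \<bullet> (X $ j) = l $ j} edge_of D)"

text \<open>The edges are nonempty, so each support number is the minimum of the corresponding normal on the
  polygon; hence the support numbers are unique.\<close>

lemma is_support_lower:
  assumes "is_support D X l" "is_support D X l'"
  shows "l' $ j \<le> l $ j"
proof -
  have "{\<mu> \<in> D. \<mu> \<bullet> (X $ j) = l $ j} edge_of D" using assms(1) unfolding is_support_def by blast
  then have "{\<mu> \<in> D. \<mu> \<bullet> (X $ j) = l $ j} \<noteq> {}" by (auto simp: edge_of_def aff_dim_empty)
  then obtain \<mu> where \<mu>: "\<mu> \<in> D" "\<mu> \<bullet> (X $ j) = l $ j" by blast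
  then have "l' $ j \<le> \<mu> \<bullet> (X $ j)" using assms(2) unfolding is_support_def by blast
  then show ?thesis by (simp only: \<mu>(2))
qed

lemma support_numbers_eq:
  assumes "is_support D X l"
  shows "support_numbers D X = l"
proof -
  have "support_numbers D X = (THE l. is_support D X l)"
    unfolding support_numbers_def is_support_def ..
  also have "\<dots> = l"
  proof (rule the_equality[of "is_support D X", OF assms])
    fix l' assume l': "is_support D X l'"
    show "l' = l"
      using is_support_lower[OF assms l'] is_support_lower[OF l' assms]
      by (simp add: vec_eq_iff order_antisym)
  qed
  finally show ?thesis .
qed

text \<open>A supporting line cuts out a face. Its dimension is at least \<open>1\<close> because it contains \<open>p\<close> and \<open>q\<close>,
  and less than \<open>2\<close> because it does not contain \<open>r\<close>.\<close>

lemma edge_of_planar_set: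
  fixes D :: "complex set"
  assumes "convex D" "\<And>\<mu>. \<mu> \<in> D \<Longrightarrow> \<mu> \<bullet> x \<ge> c"
    and "p \<in> D" "p \<bullet> x = c" "q \<in> D" "q \<bullet> x = c" "p \<noteq> q" and "r \<in> D" "r \<bullet> x \<noteq> c"
  shows "{\<mu> \<in> D. \<mu> \<bullet> x = c} edge_of D"
proof -
  have eq: "{\<mu> \<in> D. \<mu> \<bullet> x = c} = D \<inter> {\<mu>. x \<bullet> \<mu> = c}" by (auto simp: inner_commute)
  have face: "{\<mu> \<in> D. \<mu> \<bullet> x = c} face_of D"
    unfolding eq by (rule face_of_Int_supporting_hyperplane_ge) (use assms in \<open>auto simp: inner_commute\<close>)
  have "aff_dim {\<mu> \<in> D. \<mu> \<bullet> x = c} < aff_dim D"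
    by (rule face_of_aff_dim_lt[OF assms(1) face]) (use assms in blast)
  moreover have "aff_dim D \<le> 2" using aff_dim_le_DIM[of D] by simp
  moreover have "aff_dim {p, q} \<le> aff_dim {\<mu> \<in> D. \<mu> \<bullet> x = c}"
    by (rule aff_dim_subset) (use assms in auto)
  moreover have "aff_dim {p, q} = 1" using assms(7) by (simp add: aff_dim_2)
  ultimately show ?thesis using face by (simp add: edge_of_def)
qed

text \<open>Up to the common factor \<open>sin (pi / 5)\<close>, the normals are the linear forms in the oblique
  coordinates that bound the kite with axis \<open>\<i>\<close>.\<close>

lemma inner_reference_normals:
  fixes a b :: real
  defines "z \<equiv> a *\<^sub>R lside \<i> + b *\<^sub>R rside \<i>"
  shows "z \<bullet> (- Y 1) = - sin (pi / 5) * (golden * a + b)" "z \<bullet> Y 2 = sin (pi / 5) * (golden * b)"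
    "z \<bullet> (- Y 3) = sin (pi / 5) * (golden * a)" "z \<bullet> Y 4 = - sin (pi / 5) * (a + golden * b)"
proof -
  define s where "s = sin (pi / 5)"
  have Y1: "Y 1 = Complex ((golden - 1) / 2) (golden * s)"
    by (simp add: Y_def cos_2pi_5 sin_2pi_5 s_def)
  have 4: "4 * pi / 5 = pi - pi / 5" by simp
  have "cos (4 * pi / 5) = - cos (pi / 5)" "sin (4 * pi / 5) = sin (pi / 5)"
    unfolding 4 by (rule cos_pi_minus, rule sin_pi_minus)
  then have Y2: "Y 2 = Complex (- golden / 2) s"
    by (simp add: Y_def cos_pi_5 s_def)
  have 6: "6 * pi / 5 = pi + pi / 5" by simp
  have "cos (6 * pi / 5) = - cos (pi / 5)" "sin (6 * pi / 5) = - sin (pi / 5)"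
    unfolding 6 by (rule cos_periodic_pi2, rule sin_periodic_pi2)
  then have Y3: "Y 3 = Complex (- golden / 2) (- s)"
    by (simp add: Y_def cos_pi_5 s_def)
  have 8: "8 * pi / 5 = 2 * pi - 2 * pi / 5" by simp
  have "cos (8 * pi / 5) = cos (2 * pi / 5)" "sin (8 * pi / 5) = - sin (2 * pi / 5)"
    unfolding 8 by (rule cos_2pi_minus, rule sin_2pi_minus)
  then have Y4: "Y 4 = Complex ((golden - 1) / 2) (- (golden * s))"
    by (simp add: Y_def cos_2pi_5 sin_2pi_5 s_def)
  have z: "Re z = s * (a - b)" "Im z = golden * (a + b) / 2"
    by (simp_all add: z_def lside_def rside_def cos_pi_5 s_def algebra_simps)
  have gg: "golden * golden = golden + 1" using golden_sq by (simp add: power2_eq_square)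
  have "z \<bullet> (- Y 1) = - s * ((a - b) * (golden - 1) + (golden * golden) * (a + b)) / 2"
    unfolding Y1 inner_complex_def z by (simp add: field_simps)
  then show "z \<bullet> (- Y 1) = - sin (pi / 5) * (golden * a + b)"
    unfolding gg s_def by (simp add: algebra_simps)
  show "z \<bullet> Y 2 = sin (pi / 5) * (golden * b)"
    unfolding Y2 inner_complex_def z by (simp add: field_simps s_def)
  show "z \<bullet> (- Y 3) = sin (pi / 5) * (golden * a)"
    unfolding Y3 inner_complex_def z by (simp add: field_simps s_def)
  have "z \<bullet> Y 4 = s * ((a - b) * (golden - 1) - (golden * golden) * (a + b)) / 2"
    unfolding Y4 inner_complex_def z by (simp add: field_simps)
  then show "z \<bullet> Y 4 = - sin (pi / 5) * (a + golden * b)"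
    unfolding gg s_def by (simp add: algebra_simps)
qed

definition reference_support :: "real ^ 4" where
  "reference_support = vector [- sin (pi / 5) * golden, 0, 0, - sin (pi / 5) * golden]"

lemma mem_reference_kite_iff:
  "a *\<^sub>R lside \<i> + b *\<^sub>R rside \<i> \<in> wedge (1 / golden) 0 \<i> \<longleftrightarrow>
     0 \<le> a \<and> 0 \<le> b \<and> golden * a + b \<le> golden \<and> a + golden * b \<le> golden"
proof -
  have g: "golden > 0" "1 / golden \<le> 1" using golden_gt_1 by auto
  have "a + 1 / golden * b \<le> 1 \<longleftrightarrow> golden * a + b \<le> golden" for a b
    using g(1) by (simp add: field_simps)
  note this[of a b] this[of b a]
  moreover have "a *\<^sub>R lside \<i> + b *\<^sub>R rside \<i> \<in> wedge (1 / golden) 0 \<i> \<longleftrightarrow>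
      0 \<le> a \<and> 0 \<le> b \<and> max a b + 1 / golden * min a b \<le> 1"
    using mem_wedge_iff[of \<i> _ "1 / golden" 0] coords_combination[of \<i> a b] by simp
  ultimately show ?thesis unfolding max_min_le_iff[OF g(2)] by (simp only: add.commute)
qed

lemma reference_kite_eq:
  "wedge (1 / golden) 0 \<i> = (\<Inter>j. {\<mu>. \<mu> \<bullet> (reference_normals $ j) \<ge> reference_support $ j})"
    (is "?D = ?I")
proof (rule set_eqI)
  fix \<mu>
  obtain a b where \<mu>: "\<mu> = a *\<^sub>R lside \<i> + b *\<^sub>R rside \<i>" using coords[of \<i> \<mu>] by (metis complex_i_not_zero)
  have s: "sin (pi / 5) > 0" and g: "golden > 0" using sin_pi_5_pos golden_gt_1 by auto
  have le: "- sin (pi / 5) * golden \<le> - sin (pi / 5) * x \<longleftrightarrow> x \<le> golden" for x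
    using s by simp
  have pos: "0 \<le> sin (pi / 5) * (golden * x) \<longleftrightarrow> 0 \<le> x" for x
    using s g by (simp add: zero_le_mult_iff)
  have "\<mu> \<in> ?I \<longleftrightarrow> \<mu> \<bullet> (- Y 1) \<ge> - sin (pi / 5) * golden \<and> \<mu> \<bullet> Y 2 \<ge> 0 \<and>
      \<mu> \<bullet> (- Y 3) \<ge> 0 \<and> \<mu> \<bullet> Y 4 \<ge> - sin (pi / 5) * golden"
    by (simp only: INT_iff mem_Collect_eq forall_4 vector_4 ball_UNIV reference_support_def)
  also have "\<dots> \<longleftrightarrow> \<mu> \<in> ?D"
    unfolding \<mu> inner_reference_normals le pos mem_reference_kite_iff by blast
  finally show "\<mu> \<in> ?D \<longleftrightarrow> \<mu> \<in> ?I" by blast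
qed

lemma reference_kite_support: "is_support (wedge (1 / golden) 0 \<i>) reference_normals reference_support"
proof -
  let ?D = "wedge (1 / golden) 0 \<i>" and ?p = "\<lambda>a b. a *\<^sub>R lside \<i> + b *\<^sub>R rside \<i>"
  have s: "sin (pi / 5) \<noteq> 0" and g: "golden > 0" "golden > 1" "1 / golden \<le> 1"
    using sin_pi_5_pos golden_gt_1 by auto
  have tip: "golden * (1 / golden) + 1 / golden = golden" "1 / golden + golden * (1 / golden) = golden"
  proof -
    have 1: "golden * (1 / golden) = 1" using g by simp
    show "golden * (1 / golden) + 1 / golden = golden" "1 / golden + golden * (1 / golden) = golden"
      unfolding 1 using inverse_golden by linarith+
  qed
  have vertex: "?p 0 0 \<in> ?D" "?p 1 0 \<in> ?D" "?p 0 1 \<in> ?D" "?p (1 / golden) (1 / golden) \<in> ?D"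
    unfolding mem_reference_kite_iff tip using g by auto
  have ne: "?p a b \<noteq> ?p a' b'" if "a \<noteq> a' \<or> b \<noteq> b'" for a b a' b'
    using coords_combination[of \<i> a b] coords_combination[of \<i> a' b'] that by auto
  have low: "\<mu> \<bullet> (reference_normals $ j) \<ge> reference_support $ j" if "\<mu> \<in> ?D" for \<mu> j
    using that reference_kite_eq by blast
  note edge = edge_of_planar_set[OF convex_wedge[OF g(3)] low]
  note vals = vector_4 reference_support_def inner_reference_normals
  have "{\<mu> \<in> ?D. \<mu> \<bullet> (reference_normals $ j) = reference_support $ j} edge_of ?D" for j
  proof -
    consider "j = 1" | "j = 2" | "j = 3" | "j = 4" using exhaust_4[of j] by blast
    then show ?thesis
    proof cases
      case 1
      show ?thesis unfolding 1
      proof (rule edge[OF _ vertex(2) _ vertex(4) _ _ vertex(1)])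
        show "?p 1 0 \<noteq> ?p (1 / golden) (1 / golden)" by (rule ne) (use g in simp)
      qed (unfold vals tip, use s g in \<open>auto\<close>)
    next
      case 2
      show ?thesis unfolding 2
      proof (rule edge[OF _ vertex(1) _ vertex(2) _ _ vertex(4)])
        show "?p 0 0 \<noteq> ?p 1 0" by (rule ne) simp
      qed (unfold vals, use s g in \<open>auto\<close>)
    next
      case 3
      show ?thesis unfolding 3
      proof (rule edge[OF _ vertex(1) _ vertex(3) _ _ vertex(4)])
        show "?p 0 0 \<noteq> ?p 0 1" by (rule ne) simp
      qed (unfold vals, use s g in \<open>auto\<close>)
    next
      case 4
      show ?thesis unfolding 4
      proof (rule edge[OF _ vertex(3) _ vertex(4) _ _ vertex(1)])
        show "?p 0 1 \<noteq> ?p (1 / golden) (1 / golden)" by (rule ne) (use g in simp)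
      qed (unfold vals tip, use s g in \<open>auto\<close>)
    qed
  qed
  then show ?thesis unfolding is_support_def using reference_kite_eq by blast
qed

section \<open>The Delzant construction and similarities\<close>

lemma inner_rotate:
  fixes \<rho> :: complex
  assumes "cmod \<rho> = 1"
  shows "(\<rho> * x) \<bullet> (\<rho> * y) = x \<bullet> y"
proof -
  have "(\<rho> * x) \<bullet> (\<rho> * y) = ((Re \<rho>)\<^sup>2 + (Im \<rho>)\<^sup>2) * (x \<bullet> y)"
    by (simp add: inner_complex_def power2_eq_square algebra_simps)
  then show ?thesis using assms cmod_power2[of \<rho>] by simp
qed

lemma face_of_similarity:
  fixes \<rho> :: complex
  assumes "\<rho> \<noteq> 0"
  shows "(\<lambda>x. v + \<rho> * x) ` S face_of (\<lambda>x. v + \<rho> * x) ` D \<longleftrightarrow> S face_of D"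
    and "aff_dim ((\<lambda>x. v + \<rho> * x) ` S) = aff_dim S"
proof -
  have im: "(\<lambda>x. v + \<rho> * x) ` S = (+) v ` (*) \<rho> ` S" for S by (simp add: image_image)
  have lin: "linear ((*) \<rho>)" by (intro linearI) (simp_all add: distrib_left)
  have inj: "inj ((*) \<rho>)" using assms by (intro injI) simp
  show "(\<lambda>x. v + \<rho> * x) ` S face_of (\<lambda>x. v + \<rho> * x) ` D \<longleftrightarrow> S face_of D"
    unfolding im face_of_translation_eq by (rule face_of_linear_image[OF lin inj])
  show "aff_dim ((\<lambda>x. v + \<rho> * x) ` S) = aff_dim S"
    unfolding im aff_dim_translation_eq by (rule aff_dim_injective_linear_image[OF lin inj])
qed

text \<open>Under the similarity \<open>x \<mapsto> v + \<rho> x\<close> with rotated normals, the support numbers change by the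
  values of the normals at \<open>v\<close>.\<close>

definition shifted_numbers :: "complex \<Rightarrow> complex ^ 4 \<Rightarrow> real ^ 4 \<Rightarrow> real ^ 4" where
  "shifted_numbers v X l = (\<chi> j. l $ j + v \<bullet> (X $ j))"

locale similarity =
  fixes v \<rho> :: complex
  assumes norm_\<rho>: "cmod \<rho> = 1"
begin

lemma \<rho>_nz: "\<rho> \<noteq> 0" using norm_\<rho> by auto

abbreviation sim :: "complex \<Rightarrow> complex" where
  "sim x \<equiv> v + \<rho> * x"

lemma inner_sim: "sim x \<bullet> ((\<rho> *s X) $ j) = x \<bullet> (X $ j) + v \<bullet> ((\<rho> *s X) $ j)"
  by (simp add: vector_smult_component inner_add_left inner_rotate[OF norm_\<rho>])

lemma inj_sim: "inj sim" using \<rho>_nz by (intro injI) simp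

lemma facet_sim:
  "{\<mu> \<in> sim ` D. \<mu> \<bullet> ((\<rho> *s X) $ j) = shifted_numbers v (\<rho> *s X) l $ j}
     = sim ` {\<mu> \<in> D. \<mu> \<bullet> (X $ j) = l $ j}"
proof -
  have "sim x \<bullet> ((\<rho> *s X) $ j) = shifted_numbers v (\<rho> *s X) l $ j \<longleftrightarrow> x \<bullet> (X $ j) = l $ j" for x
    unfolding inner_sim by (simp add: shifted_numbers_def)
  then show ?thesis by blast
qed

lemma is_support_sim:
  assumes "is_support D X l"
  shows "is_support (sim ` D) (\<rho> *s X) (shifted_numbers v (\<rho> *s X) l)"
  unfolding is_support_def
proof
  have D: "x \<in> D \<longleftrightarrow> (\<forall>j. x \<bullet> (X $ j) \<ge> l $ j)" for x
    using assms unfolding is_support_def by blast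
  show "sim ` D = (\<Inter>j. {\<mu>. \<mu> \<bullet> ((\<rho> *s X) $ j) \<ge> shifted_numbers v (\<rho> *s X) l $ j})"
  proof (rule set_eqI)
    fix y
    define x where "x = (y - v) / \<rho>"
    have y: "y = sim x" using \<rho>_nz by (simp add: x_def)
    have "y \<in> sim ` D \<longleftrightarrow> x \<in> D" unfolding y using inj_image_mem_iff[OF inj_sim] by blast
    moreover have "shifted_numbers v (\<rho> *s X) l $ j \<le> y \<bullet> ((\<rho> *s X) $ j) \<longleftrightarrow> l $ j \<le> x \<bullet> (X $ j)" for j
      unfolding y inner_sim by (simp add: shifted_numbers_def)
    ultimately show "y \<in> sim ` D \<longleftrightarrow>
        y \<in> (\<Inter>j. {\<mu>. \<mu> \<bullet> ((\<rho> *s X) $ j) \<ge> shifted_numbers v (\<rho> *s X) l $ j})"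
      by (simp add: D)
  qed
  show "\<forall>j. {\<mu> \<in> sim ` D. \<mu> \<bullet> ((\<rho> *s X) $ j) = shifted_numbers v (\<rho> *s X) l $ j} edge_of sim ` D"
    unfolding facet_sim edge_of_def face_of_similarity[OF \<rho>_nz]
    using assms unfolding is_support_def edge_of_def by blast
qed

lemma vertex_pairs_sim:
  "vertex_pairs (sim ` D) (\<rho> *s X) (shifted_numbers v (\<rho> *s X) l) = vertex_pairs D X l"
proof -
  have ext: "sim x extreme_point_of sim ` D \<longleftrightarrow> x extreme_point_of D" for x
    using face_of_similarity(1)[OF \<rho>_nz, of v "{x}" D] by (simp add: face_of_singleton)
  have "(\<exists>y. y extreme_point_of sim ` D \<and> sim ` S \<inter> sim ` S' = {y}) \<longleftrightarrow>
      (\<exists>x. x extreme_point_of D \<and> S \<inter> S' = {x})" for S S'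
  proof -
    have "y = sim ((y - v) / \<rho>)" for y using \<rho>_nz by simp
    then have "(\<exists>y. y extreme_point_of sim ` D \<and> sim ` S \<inter> sim ` S' = {y}) \<longleftrightarrow>
      (\<exists>x. sim x extreme_point_of sim ` D \<and> sim ` S \<inter> sim ` S' = {sim x})" by metis
    also have "\<dots> \<longleftrightarrow> (\<exists>x. x extreme_point_of D \<and> sim ` (S \<inter> S') = sim ` {x})"
      by (simp only: ext image_Int[OF inj_sim] image_insert image_empty)
    finally show ?thesis by (simp only: inj_image_eq_iff[OF inj_sim])
  qed
  then show ?thesis unfolding vertex_pairs_def facet_sim by simp
qed

lemma normal_map_rotate: "normal_map (\<rho> *s X) \<theta> = \<rho> * normal_map X \<theta>"
  by (simp add: normal_map_def vector_smult_component sum_distrib_left)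

lemma lie_N_rotate: "lie_N (\<rho> *s X) = lie_N X"
  using \<rho>_nz by (simp add: lie_N_def normal_map_rotate)

text \<open>The change of the support numbers is the image of a vector of the plane under the transpose
  of \<open>normal_map\<close>; it vanishes on the kernel of \<open>normal_map\<close>.\<close>

lemma Psi_sim: "Psi (\<rho> *s X) (shifted_numbers v (\<rho> *s X) l) = Psi X l"
proof -
  have "moment_J (shifted_numbers v (\<rho> *s X) l) z \<bullet> \<xi> = moment_J l z \<bullet> \<xi>" if "\<xi> \<in> lie_N X" for z \<xi>
  proof -
    have "moment_J (shifted_numbers v (\<rho> *s X) l) z \<bullet> \<xi>
        = moment_J l z \<bullet> \<xi> + v \<bullet> normal_map (\<rho> *s X) \<xi>"
      by (simp add: inner_vec_def moment_J_def shifted_numbers_def normal_map_def inner_sum_right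
          sum.distrib[symmetric] algebra_simps)
    then show ?thesis using that by (simp add: normal_map_rotate lie_N_def)
  qed
  then show ?thesis unfolding Psi_def lie_N_rotate by (auto simp: fun_eq_iff)
qed

lemma zero_level_sim: "zero_level (\<rho> *s X) (shifted_numbers v (\<rho> *s X) l) = zero_level X l"
  unfolding zero_level_def lie_N_rotate Psi_sim ..

lemma group_N_rotate:
  assumes "\<And>z. \<rho> * z \<in> L \<longleftrightarrow> z \<in> L"
  shows "group_N L (\<rho> *s X) = group_N L X"
  unfolding group_N_def normal_map_rotate assms ..

lemma delzant_chart_sim:
  assumes "\<And>z. \<rho> * z \<in> L \<longleftrightarrow> z \<in> L"
  shows "delzant_chart L (\<rho> *s X) (shifted_numbers v (\<rho> *s X) l) i j = delzant_chart L X l i j"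
proof -
  have 1: "is_chart_point (\<rho> *s X) (shifted_numbers v (\<rho> *s X) l) i j = is_chart_point X l i j"
    by (intro ext) (simp add: is_chart_point_def zero_level_sim)
  have 2: "chart_dom (\<rho> *s X) (shifted_numbers v (\<rho> *s X) l) i j = chart_dom X l i j"
    by (simp add: chart_dom_def 1)
  have 3: "chart_point (\<rho> *s X) (shifted_numbers v (\<rho> *s X) l) i j = chart_point X l i j"
    by (intro ext) (simp add: chart_point_def 1)
  have 4: "chart_group L (\<rho> *s X) i j = chart_group L X i j"
    by (simp add: chart_group_def group_N_rotate[OF assms])
  have 5: "N_class L (\<rho> *s X) = N_class L X"
    by (intro ext) (simp add: N_class_def group_N_rotate[OF assms])
  show ?thesis unfolding delzant_chart_def 2 3 4 5 ..
qed

lemma delzant_sim: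
  assumes "is_support D X l" "\<And>z. \<rho> * z \<in> L \<longleftrightarrow> z \<in> L"
  shows "delzant L (\<rho> *s X) (sim ` D) = delzant L X D"
proof -
  have N: "N_class L (\<rho> *s X) = N_class L X"
    by (intro ext) (simp add: N_class_def group_N_rotate[OF assms(2)])
  show ?thesis
    unfolding delzant_def support_numbers_eq[OF assms(1)] support_numbers_eq[OF is_support_sim[OF assms(1)]]
      Let_def zero_level_sim vertex_pairs_sim delzant_chart_sim[OF assms(2)] N ..
qed

end

lemma Q_minus: "z \<in> Q \<Longrightarrow> - z \<in> Q"
proof -
  assume "z \<in> Q"
  then obtain n :: "nat \<Rightarrow> int" where "z = (\<Sum>k<5. of_int (n k) * Y k)" unfolding Q_def by blast
  then have "- z = (\<Sum>k<5. of_int ((- n) k) * Y k)" by (simp add: sum_negf)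
  then show "- z \<in> Q" unfolding Q_def by blast
qed

text \<open>Multiplication by \<open>Y 1\<close> permutes the generators of the quasilattice cyclically, and the
  multiplications by the other \<open>Y k\<close> are its powers.\<close>

lemma Q_rotate: "z \<in> Q \<Longrightarrow> Y 1 * z \<in> Q"
proof -
  assume "z \<in> Q"
  then obtain n :: "nat \<Rightarrow> int" where z: "z = (\<Sum>k<5. of_int (n k) * Y k)" unfolding Q_def by blast
  have 5: "{..<5} = {0, 1, 2, 3, 4 :: nat}" by auto
  have Y: "Y 1 * (of_int m * Y k) = of_int m * Y (1 + k)" for m k
    unfolding Y_mult[symmetric] by (simp only: mult.left_commute)
  have "Y 5 = Y 0" by (simp add: Y_eq_cis)
  then have "Y 1 * z = (\<Sum>k<5. of_int ((\<lambda>k. if k = 0 then n 4 else n (k - 1)) k) * Y k)"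
    unfolding z sum_distrib_left Y 5 by (simp add: numeral_2_eq_2[symmetric])
  then show "Y 1 * z \<in> Q"
    unfolding Q_def by (intro CollectI exI[of _ "\<lambda>k. if k = 0 then n 4 else n (k - 1)"]) simp
qed

lemma Y_mult_Q_iff: "Y k * z \<in> Q \<longleftrightarrow> z \<in> Q"
proof -
  have fwd: "z \<in> Q \<Longrightarrow> Y k * z \<in> Q" for k z
  proof (induction k)
    case (Suc k)
    then show ?case using Q_rotate[of "Y k * z"] Y_mult[of 1 k] by (simp add: mult.assoc[symmetric])
  qed (simp add: Y_eq_cis)
  have "2 * pi * real (4 * k + k) / 5 = 2 * pi * real k" by simp
  then have "Y (4 * k + k) = 1" unfolding Y_eq_cis by (simp only: cis_multiple_2pi Ints_of_nat)
  moreover have "Y (4 * k) * (Y k * z) = Y (4 * k + k) * z"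
    by (simp only: mult.assoc[symmetric] Y_mult)
  ultimately have "Y (4 * k) * (Y k * z) = z" by simp
  then show ?thesis using fwd[of z k] fwd[of "Y k * z" "4 * k"] by metis
qed

section \<open>Compactness and connectedness\<close>

lemma continuous_map_quotient_topology: "continuous_map T (quotient_topology T q) q"
  and topspace_quotient_topology: "topspace (quotient_topology T q) = q ` topspace T"
proof -
  have "openin (quotient_topology T q) (q ` topspace T)"
  proof -
    have "{x \<in> topspace T. q x \<in> q ` topspace T} = topspace T" by blast
    then show ?thesis unfolding openin_quotient_topology by simp
  qed
  moreover have "U \<subseteq> q ` topspace T" if "openin (quotient_topology T q) U" for U
    using that unfolding openin_quotient_topology by blast
  ultimately show top: "topspace (quotient_topology T q) = q ` topspace T"
    by (meson openin_subset openin_topspace subset_antisym)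
  show "continuous_map T (quotient_topology T q) q"
    unfolding continuous_map top by (auto simp: openin_quotient_topology)
qed

lemma linear_normal_map: "linear (normal_map X)"
  by (intro linearI)
    (simp_all add: normal_map_def scaleR_left_distrib sum.distrib scaleR_right.sum)

text \<open>The transpose of \<open>normal_map X\<close> sends \<open>\<mu>\<close> to the vector of the values of the normals at \<open>\<mu>\<close>; its
  image is the orthogonal complement of the kernel of \<open>normal_map X\<close>.\<close>

lemma orthogonal_lie_N:
  assumes "\<And>\<xi>. \<xi> \<in> lie_N X \<Longrightarrow> y \<bullet> \<xi> = 0"
  shows "\<exists>\<mu>. \<forall>j. y $ j = \<mu> \<bullet> (X $ j)"
proof -
  let ?f = "normal_map X"
  have "?f -` {0} = lie_N X" by (auto simp: lie_N_def)
  then have "y \<in> (?f -` {0})\<^sup>\<bottom>"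
    using assms by (auto simp: orthogonal_comp_def orthogonal_def inner_commute)
  also have "(?f -` {0})\<^sup>\<bottom> = range (adjoint ?f)"
    unfolding ker_orthogonal_comp_adjoint[OF linear_normal_map]
    by (intro orthogonal_comp_self linear_subspace_image adjoint_linear linear_normal_map subspace_UNIV)
  finally obtain \<mu> where \<mu>: "y = adjoint ?f \<mu>" by blast
  have "y $ j = \<mu> \<bullet> (X $ j)" for j
  proof -
    have "y $ j = axis j 1 \<bullet> adjoint ?f \<mu>" by (simp add: \<mu> inner_axis')
    also have "\<dots> = ?f (axis j 1) \<bullet> \<mu>"
      using adjoint_works[OF linear_normal_map, of "axis j 1" X \<mu>] by simp
    also have "?f (axis j 1) = X $ j"
      unfolding normal_map_def axis_def by (simp add: if_distrib[of "\<lambda>x. x *\<^sub>R _"] cong: if_cong)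
    finally show ?thesis by (simp add: inner_commute)
  qed
  then show ?thesis by blast
qed

text \<open>On the level set, \<open>moment_J l z\<close> collects the values of the normals at a point \<open>\<mu>\<close>. The squared
  moduli of the coordinates of \<open>z\<close> are then the numbers \<open>\<mu> \<bullet> X j - l j\<close>, so \<open>\<mu>\<close> belongs to the
  polygon, while the phases of \<open>z\<close> are arbitrary.\<close>

lemma zero_level_image:
  assumes D: "D = (\<Inter>j. {\<mu>. \<mu> \<bullet> (X $ j) \<ge> l $ j})"
  shows "zero_level X l =
     (\<lambda>(\<mu>, \<theta>). \<chi> j. exp (2 * pi * \<i> * of_real (\<theta> $ j)) * of_real (sqrt (\<mu> \<bullet> (X $ j) - l $ j)))
       ` (D \<times> cbox 0 1)" (is "_ = ?f ` _")
proof (intro equalityI subsetI)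
  fix z assume "z \<in> zero_level X l"
  then have "moment_J l z \<bullet> \<xi> = 0" if "\<xi> \<in> lie_N X" for \<xi>
    using that by (auto simp: zero_level_def Psi_def)
  then obtain \<mu> where \<mu>: "\<forall>j. moment_J l z $ j = \<mu> \<bullet> (X $ j)"
    using orthogonal_lie_N by blast
  have m: "\<mu> \<bullet> (X $ j) - l $ j = (cmod (z $ j))\<^sup>2" for j
    using spec[OF \<mu>, of j] by (simp add: moment_J_def)
  have "\<mu> \<in> D" unfolding D
  proof (intro INT_I CollectI)
    fix j show "l $ j \<le> \<mu> \<bullet> (X $ j)" using m[of j] zero_le_power2[of "cmod (z $ j)"] by linarith
  qed
  define \<theta> :: "real ^ 4" where "\<theta> = (\<chi> j. Arg2pi (z $ j) / (2 * pi))"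
  have "\<theta> \<in> cbox 0 1"
    using Arg2pi_ge_0 Arg2pi_lt_2pi by (auto simp: mem_box_cart \<theta>_def less_imp_le)
  moreover have "?f (\<mu>, \<theta>) = z"
  proof -
    have "exp (2 * pi * \<i> * of_real (\<theta> $ j)) * of_real (sqrt (\<mu> \<bullet> (X $ j) - l $ j)) = z $ j" for j
      using Arg2pi_eq[of "z $ j"] by (simp add: m \<theta>_def mult_ac)
    then show ?thesis by (simp add: vec_eq_iff)
  qed
  ultimately show "z \<in> ?f ` (D \<times> cbox 0 1)" using \<open>\<mu> \<in> D\<close> by force
next
  fix z assume "z \<in> ?f ` (D \<times> cbox 0 1)"
  then obtain \<mu> \<theta> where \<mu>: "\<mu> \<in> D"
    and z: "z = (\<chi> j. exp (2 * pi * \<i> * of_real (\<theta> $ j)) * of_real (sqrt (\<mu> \<bullet> (X $ j) - l $ j)))"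
    by auto
  have "moment_J l z $ j = \<mu> \<bullet> (X $ j)" for j
    using \<mu> unfolding D z by (simp add: moment_J_def norm_mult power_mult_distrib)
  then have "moment_J l z \<bullet> \<xi> = \<mu> \<bullet> normal_map X \<xi>" for \<xi>
    by (simp add: inner_vec_def normal_map_def inner_sum_right mult.commute)
  then show "z \<in> zero_level X l" by (simp add: zero_level_def Psi_def lie_N_def)
qed

lemma delzant_compact_connected:
  assumes "is_support D X l" "compact D" "convex D"
  shows "compact_space (carrier_top (delzant L X D))" "connected_space (carrier_top (delzant L X D))"
proof -
  have D: "D = (\<Inter>j. {\<mu>. \<mu> \<bullet> (X $ j) \<ge> l $ j})" using assms(1) unfolding is_support_def by blast
  have top: "carrier_top (delzant L X D) = quotient_topology (top_of_set (zero_level X l)) (N_class L X)"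
    by (simp add: delzant_def Let_def support_numbers_eq[OF assms(1)])
  have cont: "continuous_on (D \<times> cbox 0 1)
     (\<lambda>(\<mu>, \<theta> :: real ^ 4). \<chi> j. exp (2 * pi * \<i> * of_real (\<theta> $ j)) * of_real (sqrt (\<mu> \<bullet> (X $ j) - l $ j)))"
    unfolding case_prod_beta by (intro continuous_intros)
  have "compact (D \<times> cbox 0 (1 :: real ^ 4))" by (intro compact_Times assms compact_cbox)
  then have "compact (zero_level X l)"
    unfolding zero_level_image[OF D] by (rule compact_continuous_image[OF cont])
  then have c: "compactin (top_of_set (zero_level X l)) (topspace (top_of_set (zero_level X l)))"
    by (simp add: compactin_subtopology)
  have "connected (D \<times> cbox 0 (1 :: real ^ 4))"
    by (intro connected_Times convex_connected assms convex_box)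
  then have "connected (zero_level X l)"
    unfolding zero_level_image[OF D] by (rule connected_continuous_image[OF cont])
  then have "connectedin (top_of_set (zero_level X l)) (topspace (top_of_set (zero_level X l)))"
    by (simp add: connectedin_subtopology)
  then show "connected_space (carrier_top (delzant L X D))"
    unfolding top connectedin_topspace[symmetric] topspace_quotient_topology
    by (rule connectedin_continuous_map_image[OF continuous_map_quotient_topology])
  show "compact_space (carrier_top (delzant L X D))"
    unfolding top compact_space_def topspace_quotient_topology
    by (rule image_compactin[OF c continuous_map_quotient_topology])
qed

section \<open>All kites of the tiling give the same quasifold\<close>

theorem theorem5p1:
  fixes T :: "tile set" and E B A G :: complex and \<Delta> :: "complex set"
  assumes "kite_dart_tiling T"
    and "normalized_coordinates T"
    and "Kite E B A G \<in> T" and "\<Delta> = region (Kite E B A G)"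
  shows "compact_space (carrier_top (kite_quasifold \<Delta>))
       \<and> connected_space (carrier_top (kite_quasifold \<Delta>))
       \<and> kite_quasifold \<Delta> = M0_plus"
proof -
  let ?w = "A - E" and ?D = "wedge (1 / golden) 0 \<i>"
  have w: "?w ^ 10 = - 1" by (rule kite_axis_power_10[OF assms(1-3)])
  have "is_kite E B A G" using assms(1,3) by (auto simp: kite_dart_tiling_def)
  then have \<Delta>: "\<Delta> = wedge (1 / golden) E ?w" using kite_wedge(2) assms(4) by simp
  obtain k where k: "?w = Ystar k \<or> ?w = - Ystar k" using power_10_eq_minus_1[OF w] by blast
  then have \<rho>: "?w / \<i> = Y k \<or> ?w / \<i> = - Y k" by (auto simp: Ystar_eq)
  then have "cmod (?w / \<i>) = 1" by (metis norm_Y norm_minus_cancel)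
  then interpret similarity E "?w / \<i>" by unfold_locales
  have "?w / \<i> * \<i> = ?w" by (rule nonzero_divide_eq_eq[THEN iffD1, symmetric]) simp_all
  then have "sim ` ?D = \<Delta>" unfolding wedge_similarity \<Delta> by simp
  moreover have "?w / \<i> * z \<in> Q \<longleftrightarrow> z \<in> Q" for z
    using \<rho>
  proof
    assume r: "?w / \<i> = Y k"
    show ?thesis unfolding r by (rule Y_mult_Q_iff)
  next
    assume r: "?w / \<i> = - Y k"
    show ?thesis
      unfolding r mult_minus_left
      using Y_mult_Q_iff[of k z] Q_minus[of "Y k * z"] Q_minus[of "- (Y k * z)"] by auto
  qed
  ultimately have "kite_quasifold \<Delta> = delzant Q reference_normals ?D"
    using delzant_sim[OF reference_kite_support, of Q]
    by (simp only: kite_quasifold_def kite_normals_eq[OF w] \<Delta>)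
  also have "\<dots> = M0_plus"
    by (simp add: M0_plus_def Delta_plus_eq Ystar_eq Y_eq_cis)
  finally have eq: "kite_quasifold \<Delta> = M0_plus" .
  have c: "0 < 1 / golden" "1 / golden \<le> 1" using golden_gt_1 by auto
  have "compact ?D" unfolding wedge_eq_hull[OF c, symmetric] by (intro finite_imp_compact_convex_hull) simp
  then show ?thesis
    using delzant_compact_connected[OF reference_kite_support _ convex_wedge[OF c(2)], of Q] eq
      \<open>kite_quasifold \<Delta> = delzant Q reference_normals ?D\<close> by simp
qed

end
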